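(* Let $n\ge 2$, let $\Omega\subset\mathbb{R}^n$ be a bounded open set, and let $r>n$ and $q>p\ge 2$ satisfy $$1\le \frac{q}{p}<1+\frac1n-\frac1r .$$ Let $f:\Omega\times\mathbb{R}^n\to[0,+\infty)$ be a Carathéodory function, convex and of class $C^2$ in the second variable. Suppose there are constants $\nu,L>0$ and a function $h:\Omega\to[0,+\infty)$ with $h\in L^r_{\mathrm{loc}}(\Omega)$ such that, for a.e. $x\in\Omega$ and all $\xi,\lambda\in\mathbb{R}^n$, $$\nu(1+|\xi|^2)^{\frac p2}\le f(x,\xi)\le L(1+|\xi|^2)^{\frac q2},$$ $$\nu(1+|\xi|^2)^{\frac{p-2}{2}}|\lambda|^2\le\sum_{i,j}f_{\xi_i\xi_j}(x,\xi)\lambda_i\lambda_j\le L(1+|\xi|^2)^{\frac{q-2}{2}}|\lambda|^2,$$ $$|f_{x\xi}(x,\xi)|\le h(x)(1+|\xi|^2)^{\frac{q-1}{2}} .$$ Let the obstacle $\psi:\Omega\to[-\infty,+\infty)$ belong to $W^{1,p}(\Omega)$, let $u_0\in W^{1,q}(\Omega)$ be a fixed boundary value, and let $\mathcal{F}$, $\overline{\mathcal{F}}$, $\mathcal{K}_\psi(\Omega)$ and $\mathcal{K}^*_\psi(\Omega)$ be as defined in the context, with $\mathcal{K}_\psi(\Omega)\neq\emptyset$. Then for each $u\in\mathcal{K}_\psi(\Omega)$ there exists a sequence $\{u_k\}\subset\mathcal{K}^*_\psi(\Omega)$ such that $u_k\rightharpoonup u$ weakly in $W^{1,p}(\Omega)$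 and $$\overline{\mathcal{F}}(u)=\lim_{k\to+\infty}\mathcal{F}(u_k).$$
   Context: Here $f_{\xi_i\xi_j}$ are the second derivatives of $f$ in the gradient variable $\xi$, and $f_{x\xi}$ denotes the derivative in $x$ of the map $x\mapsto D_\xi f(x,\xi)$. Set $\mathcal{F}(w)=\int_\Omega f(x,Dw)\,dx$, $$\mathcal{K}_\psi(\Omega)=\{w\in u_0+W^{1,p}_0(\Omega): w\ge\psi\text{ a.e. in }\Omega\},$$ $$\mathcal{K}^*_\psi(\Omega)=\{w\in u_0+W^{1,q}_0(\Omega): w\ge\psi\text{ a.e. in }\Omega\}.$$ For $u\in\mathcal{K}_\psi(\Omega)$ let $$\mathcal{C}(u)=\{\{u_j\}_{j\in\mathbb{N}}\subset\mathcal{K}^*_\psi(\Omega): u_j\rightharpoonup u\text{ weakly in }W^{1,p}(\Omega)\}.$$ The relaxed functional is $$\overline{\mathcal{F}}(u)=\inf_{\{u_j\}\in\mathcal{C}(u)}\ \liminf_{j\to+\infty}\mathcal{F}(u_j).$$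
   Formalization: The formal statement assumes in addition that C(u) is nonempty; without this the claim fails, e.g. for p<n<q and an obstacle in W^{1,p} unbounded above near an interior point, where K*_ψ(Ω) is empty. *)

theory Defs
  imports "HOL-Analysis.Analysis"
begin

section \<open>Derivatives and test functions\<close>

definition partial :: "'n::finite \<Rightarrow> (real^'n \<Rightarrow> real) \<Rightarrow> real^'n \<Rightarrow> real" where
  "partial i g \<xi> = frechet_derivative g (at \<xi>) (axis i 1)"

text \<open>Functions of class \<open>C\<^sup>k\<close> on the whole space. Differentiability is required explicitly
  because \<^const>\<open>frechet_derivative\<close> is unspecified where it fails.\<close>

fun C_k :: "nat \<Rightarrow> (real^'n::finite \<Rightarrow> real) \<Rightarrow> bool" where
  "C_k 0 g \<longleftrightarrow> continuous_on UNIV g"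
| "C_k (Suc k) g \<longleftrightarrow> (\<forall>\<xi>. g differentiable (at \<xi>)) \<and> (\<forall>i. C_k k (partial i g))"

definition test_functions :: "(real^'n::finite) set \<Rightarrow> (real^'n \<Rightarrow> real) set" where
  "test_functions \<Omega> = {\<phi>. (\<forall>k. C_k k \<phi>) \<and> compact (closure {x. \<phi> x \<noteq> 0}) \<and> closure {x. \<phi> x \<noteq> 0} \<subseteq> \<Omega>}"


section \<open>Lebesgue and Sobolev spaces\<close>

text \<open>Elements of these spaces are honest functions rather than classes modulo null sets;
  their values outside \<open>\<Omega>\<close> are irrelevant. All notions below are invariant under changing
  a function on a null subset of \<open>\<Omega>\<close>.\<close>

definition Lp :: "(real^'n::finite) set \<Rightarrow> real \<Rightarrow> (real^'n \<Rightarrow> 'b::euclidean_space) set" where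
  "Lp \<Omega> p = {g. g \<in> borel_measurable (lebesgue_on \<Omega>) \<and>
                 integrable (lebesgue_on \<Omega>) (\<lambda>x. norm (g x) powr p)}"

definition Lp_loc :: "(real^'n::finite) set \<Rightarrow> real \<Rightarrow> (real^'n \<Rightarrow> 'b::euclidean_space) set" where
  "Lp_loc \<Omega> p = {g. \<forall>K. compact K \<and> K \<subseteq> \<Omega> \<longrightarrow> g \<in> Lp K p}"

definition has_weak_gradient ::
    "(real^'n::finite) set \<Rightarrow> (real^'n \<Rightarrow> real) \<Rightarrow> (real^'n \<Rightarrow> real^'n) \<Rightarrow> bool" where
  "has_weak_gradient \<Omega> w g \<longleftrightarrow>
     w \<in> Lp_loc \<Omega> 1 \<and> g \<in> Lp_loc \<Omega> 1 \<and>
     (\<forall>\<phi>\<in>test_functions \<Omega>. \<forall>i.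
        (LINT x|lebesgue_on \<Omega>. w x * partial i \<phi> x) = - (LINT x|lebesgue_on \<Omega>. g x $ i * \<phi> x))"

text \<open>The weak gradient is unique up to null sets (for open \<open>\<Omega>\<close>), so the choice is immaterial.\<close>

definition weak_gradient :: "(real^'n::finite) set \<Rightarrow> (real^'n \<Rightarrow> real) \<Rightarrow> real^'n \<Rightarrow> real^'n" where
  "weak_gradient \<Omega> w = (SOME g. has_weak_gradient \<Omega> w g)"

definition sobolev :: "(real^'n::finite) set \<Rightarrow> real \<Rightarrow> (real^'n \<Rightarrow> real) set" where
  "sobolev \<Omega> p = {w. w \<in> Lp \<Omega> p \<and> (\<exists>g. has_weak_gradient \<Omega> w g \<and> g \<in> Lp \<Omega> p)}"

definition sobolev_norm :: "(real^'n::finite) set \<Rightarrow> real \<Rightarrow> (real^'n \<Rightarrow> real) \<Rightarrow> real" where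
  "sobolev_norm \<Omega> p w =
     ((LINT x|lebesgue_on \<Omega>. \<bar>w x\<bar> powr p) +
      (LINT x|lebesgue_on \<Omega>. norm (weak_gradient \<Omega> w x) powr p)) powr (1 / p)"

text \<open>\<open>W\<^sub>0\<^sup>1\<^sup>,\<^sup>p(\<Omega>)\<close>: the closure of the test functions in \<open>W\<^sup>1\<^sup>,\<^sup>p(\<Omega>)\<close>.\<close>

definition sobolev0 :: "(real^'n::finite) set \<Rightarrow> real \<Rightarrow> (real^'n \<Rightarrow> real) set" where
  "sobolev0 \<Omega> p = {w \<in> sobolev \<Omega> p.
     \<forall>e>0. \<exists>\<phi>\<in>test_functions \<Omega>. sobolev_norm \<Omega> p (\<lambda>x. w x - \<phi> x) < e}"

text \<open>Bounded linear functionals on \<open>W\<^sup>1\<^sup>,\<^sup>p(\<Omega>)\<close>; boundedness forces \<open>l\<close> to respect equality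
  almost everywhere, so these are exactly the elements of the dual space.\<close>

definition sobolev_dual :: "(real^'n::finite) set \<Rightarrow> real \<Rightarrow> ((real^'n \<Rightarrow> real) \<Rightarrow> real) set" where
  "sobolev_dual \<Omega> p = {l.
     (\<forall>v\<in>sobolev \<Omega> p. \<forall>w\<in>sobolev \<Omega> p. l (\<lambda>x. v x + w x) = l v + l w) \<and>
     (\<forall>c. \<forall>w\<in>sobolev \<Omega> p. l (\<lambda>x. c * w x) = c * l w) \<and>
     (\<exists>B. \<forall>w\<in>sobolev \<Omega> p. \<bar>l w\<bar> \<le> B * sobolev_norm \<Omega> p w)}"

definition weakly_converges ::
    "(real^'n::finite) set \<Rightarrow> real \<Rightarrow> (nat \<Rightarrow> real^'n \<Rightarrow> real) \<Rightarrow> (real^'n \<Rightarrow> real) \<Rightarrow> bool" where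
  "weakly_converges \<Omega> p U u \<longleftrightarrow>
     (\<forall>k. U k \<in> sobolev \<Omega> p) \<and> u \<in> sobolev \<Omega> p \<and>
     (\<forall>l\<in>sobolev_dual \<Omega> p. (\<lambda>k. l (U k)) \<longlonglongrightarrow> l u)"


section \<open>The obstacle problem and the relaxed functional\<close>

definition caratheodory :: "(real^'n::finite) set \<Rightarrow> (real^'n \<Rightarrow> real^'n \<Rightarrow> real) \<Rightarrow> bool" where
  "caratheodory \<Omega> f \<longleftrightarrow>
     (\<forall>\<xi>. (\<lambda>x. f x \<xi>) \<in> borel_measurable (lebesgue_on \<Omega>)) \<and>
     (AE x in lebesgue_on \<Omega>. continuous_on UNIV (f x))"

text \<open>An obstacle with values in \<open>[-\<infinity>,+\<infinity>)\<close> that belongs to \<open>W\<^sup>1\<^sup>,\<^sup>p(\<Omega>)\<close>; in particular it is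
  finite almost everywhere, and \<^const>\<open>real_of_ereal\<close> only changes it on a null set.\<close>

definition sobolev_obstacle :: "(real^'n::finite) set \<Rightarrow> real \<Rightarrow> (real^'n \<Rightarrow> ereal) \<Rightarrow> bool" where
  "sobolev_obstacle \<Omega> p \<psi> \<longleftrightarrow>
     (\<forall>x\<in>\<Omega>. \<psi> x < \<infinity>) \<and> (AE x in lebesgue_on \<Omega>. \<psi> x \<noteq> -\<infinity>) \<and>
     (\<lambda>x. real_of_ereal (\<psi> x)) \<in> sobolev \<Omega> p"

text \<open>With \<open>s = p\<close> this is \<open>K\<^sub>\<psi>(\<Omega>)\<close>, with \<open>s = q\<close> it is \<open>K\<^sup>*\<^sub>\<psi>(\<Omega>)\<close>.\<close>

definition obstacle_class ::
    "(real^'n::finite) set \<Rightarrow> real \<Rightarrow> (real^'n \<Rightarrow> real) \<Rightarrow> (real^'n \<Rightarrow> ereal) \<Rightarrow> (real^'n \<Rightarrow> real) set" where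
  "obstacle_class \<Omega> s u\<^sub>0 \<psi> =
     {w. (\<lambda>x. w x - u\<^sub>0 x) \<in> sobolev0 \<Omega> s \<and> (AE x in lebesgue_on \<Omega>. \<psi> x \<le> ereal (w x))}"

definition energy ::
    "(real^'n::finite) set \<Rightarrow> (real^'n \<Rightarrow> real^'n \<Rightarrow> real) \<Rightarrow> (real^'n \<Rightarrow> real) \<Rightarrow> ennreal" where
  "energy \<Omega> f w = (\<integral>\<^sup>+ x. ennreal (f x (weak_gradient \<Omega> w x)) \<partial>lebesgue_on \<Omega>)"

definition approximations ::
    "(real^'n::finite) set \<Rightarrow> real \<Rightarrow> real \<Rightarrow> (real^'n \<Rightarrow> real) \<Rightarrow> (real^'n \<Rightarrow> ereal) \<Rightarrow>
     (real^'n \<Rightarrow> real) \<Rightarrow> (nat \<Rightarrow> real^'n \<Rightarrow> real) set" where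
  "approximations \<Omega> p q u\<^sub>0 \<psi> u =
     {U. (\<forall>j. U j \<in> obstacle_class \<Omega> q u\<^sub>0 \<psi>) \<and> weakly_converges \<Omega> p U u}"

text \<open>The infimum is meant over a nonempty class of approximating sequences; on an empty class
  this definition returns \<open>\<infinity>\<close>. The class can be empty even for \<open>u \<in> K\<^sub>\<psi>(\<Omega>)\<close>: if \<open>p < n < q\<close>
  and \<open>\<psi> \<in> W\<^sup>1\<^sup>,\<^sup>p(\<Omega>)\<close> is not essentially bounded above on some
  compact subset of \<open>\<Omega>\<close>, then no function of \<open>W\<^sup>1\<^sup>,\<^sup>q(\<Omega>)\<close>
  lies above \<open>\<psi>\<close>.\<close>

definition relaxed_energy ::
    "(real^'n::finite) set \<Rightarrow> real \<Rightarrow> real \<Rightarrow> (real^'n \<Rightarrow> real^'n \<Rightarrow> real) \<Rightarrow>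
     (real^'n \<Rightarrow> real) \<Rightarrow> (real^'n \<Rightarrow> ereal) \<Rightarrow> (real^'n \<Rightarrow> real) \<Rightarrow> ennreal" where
  "relaxed_energy \<Omega> p q f u\<^sub>0 \<psi> u =
     (INF U \<in> approximations \<Omega> p q u\<^sub>0 \<psi> u. liminf (\<lambda>j. energy \<Omega> f (U j)))"

end

theory Submission
  imports Defs "HOL-Library.Function_Algebras"
begin

text \<open>A diagonal sequence can be avoided because the energy is convex. If \<open>R\<close> is the relaxed energy
  of \<open>u\<close>, assumed finite, then the admissible functions of energy at most \<open>R + \<epsilon>\<close> form a convex set
  that an approximating sequence, weakly convergent to \<open>u\<close>, visits infinitely often. By Mazur's lemma this set
  contains functions arbitrarily close to \<open>u\<close> in the norm of \<open>W\<^sup>1\<^sup>,\<^sup>p\<close>. Choosing one at distance less than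
  \<open>\<epsilon>\<close> for every \<open>\<epsilon> = 1/m\<close> gives a strongly, hence weakly, convergent sequence; the limes superior of its
  energies is at most \<open>R\<close>, and the limes inferior is at least \<open>R\<close> by definition of \<open>R\<close>.\<close>

section \<open>Linear functionals dominated by a seminorm\<close>

text \<open>Functions are not identified almost everywhere, so the Sobolev norm is only a seminorm,
  on a subspace of the space of all functions. Mazur's lemma therefore rests on a Hahn--Banach
  theorem relative to a subspace and a seminorm, which yields a functional bounded by that seminorm
  and hence one that weak convergence may be tested with. The approximant belongs to the convex set
  itself, not merely to its closure; this keeps the boundary condition and the obstacle in W^{1,q}
  although distances are measured in W^{1,p}. The weak gradient is picked by \<open>SOME\<close>.
  Its linearity, behind both Minkowski's inequality and the convexity of the energy, holds only
  almost everywhere and comes from uniqueness of weak gradients, hence from the fundamental lemma of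
  the calculus of variations; this is why explicit bump functions are built. Integration by parts
  puts the test functions into the Sobolev space, so that the seminorm inequalities apply to the
  approximation errors in \<open>sobolev0\<close>.\<close>

definition sublinear_on :: "'a::real_vector set \<Rightarrow> ('a \<Rightarrow> real) \<Rightarrow> bool" where
  "sublinear_on V q \<longleftrightarrow> q 0 = 0 \<and> (\<forall>x\<in>V. \<forall>y\<in>V. q (x + y) \<le> q x + q y) \<and>
     (\<forall>c>0. \<forall>x\<in>V. q (c *\<^sub>R x) \<le> c * q x)"

lemma sublinear_on_ge:
  assumes "subspace V" "sublinear_on V q" "x \<in> V"
  shows "- q (- x) \<le> q x"
proof -
  have "q (x + - x) \<le> q x + q (- x)"
    using assms subspace_neg unfolding sublinear_on_def by blast
  moreover have "q 0 = 0" using assms unfolding sublinear_on_def by blast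
  ultimately show ?thesis by simp
qed

lemma sublinear_on_scale:
  assumes "subspace V" "sublinear_on V q" "x \<in> V" "c > 0"
  shows "q (c *\<^sub>R x) = c * q x"
proof (rule antisym)
  show "q (c *\<^sub>R x) \<le> c * q x" using assms unfolding sublinear_on_def by blast
  have "c *\<^sub>R x \<in> V" using assms subspace_scale by blast
  then have "q (inverse c *\<^sub>R (c *\<^sub>R x)) \<le> inverse c * q (c *\<^sub>R x)"
    using assms unfolding sublinear_on_def by (meson positive_imp_inverse_positive)
  then show "c * q x \<le> q (c *\<^sub>R x)" using \<open>c > 0\<close> by (simp add: field_simps)
qed

text \<open>A pair (k, s) in the convex cone \<open>K\<close> is a demand l k \<ge> s on a later
  linear minorant l: from l \<le> q' one gets - l k = l (- k) \<le> - s. The infimum of q (x + k) -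
  s over \<open>K\<close> meets all demands at once; the cone property makes it sublinear, and s
  \<le> q k keeps it bounded below.\<close>

lemma sublinear_on_inf_convolution:
  fixes V :: "'a::real_vector set" and K :: "('a \<times> real) set"
  assumes V: "subspace V" and q: "sublinear_on V q"
    and K0: "(0, 0) \<in> K" and Kadd: "\<And>a b. a \<in> K \<Longrightarrow> b \<in> K \<Longrightarrow> a + b \<in> K"
    and Kscale: "\<And>c a. c > 0 \<Longrightarrow> a \<in> K \<Longrightarrow> c *\<^sub>R a \<in> K"
    and Kq: "\<And>k s. (k, s) \<in> K \<Longrightarrow> k \<in> V \<and> s \<le> q k"
  shows "\<exists>q'. sublinear_on V q' \<and> (\<forall>x\<in>V. q' x \<le> q x) \<and> (\<forall>(k, s)\<in>K. q' (- k) \<le> - s)"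
proof -
  define q' where "q' x = (INF a\<in>K. q (x + fst a) - snd a)" for x
  \<comment> \<open>Subadditivity cancels x, giving q k \<le> q (x + k) + q (- x), and s \<le> q k
    then leaves a lower bound that does not depend on the pair.\<close>
  have low: "- q (- x) \<le> q (x + fst a) - snd a" if "x \<in> V" "a \<in> K" for x a
  proof -
    have *: "fst a \<in> V" "snd a \<le> q (fst a)" using Kq[of "fst a" "snd a"] that by auto
    have "q ((x + fst a) + - x) \<le> q (x + fst a) + q (- x)"
      using q * that V unfolding sublinear_on_def by (meson subspace_add subspace_neg)
    then show ?thesis using * by simp
  qed
  have bdd: "bdd_below ((\<lambda>a. q (x + fst a) - snd a) ` K)" if "x \<in> V" for x
    using low[OF that] by (rule bdd_belowI2)
  have le: "q' x \<le> q (x + fst a) - snd a" if "x \<in> V" "a \<in> K" for x a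
    unfolding q'_def using that bdd by (intro cINF_lower) auto
  have ge: "b \<le> q' x" if "\<And>a. a \<in> K \<Longrightarrow> b \<le> q (x + fst a) - snd a" for b x
    unfolding q'_def using that K0 by (intro cINF_greatest) auto
  have q0: "q 0 = 0" using q unfolding sublinear_on_def by blast
  have le_q: "q' x \<le> q x" if "x \<in> V" for x
    using le[OF that K0] by simp
  have neg: "q' (- k) \<le> - s" if "(k, s) \<in> K" for k s
    using le[OF _ that, of "- k"] Kq[OF that] V q0 by (simp add: subspace_neg)
  have "sublinear_on V q'"
    unfolding sublinear_on_def
  proof (intro conjI ballI allI impI)
    have "0 \<in> V" using V by (rule subspace_0)
    have "0 \<le> q' 0" using ge low[OF \<open>0 \<in> V\<close>] q0 by (metis minus_zero)
    then show "q' 0 = 0" using le_q[OF \<open>0 \<in> V\<close>] q0 by simp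
  next
    fix x y assume xy: "x \<in> V" "y \<in> V"
    have "q' (x + y) \<le> (q (x + fst a) - snd a) + (q (y + fst b) - snd b)" if "a \<in> K" "b \<in> K" for a b
    proof -
      have "q' (x + y) \<le> q ((x + y) + fst (a + b)) - snd (a + b)"
        using xy that V Kadd by (intro le) (auto intro: subspace_add)
      also have "(x + y) + fst (a + b) = (x + fst a) + (y + fst b)" by simp
      also have "q \<dots> \<le> q (x + fst a) + q (y + fst b)"
        using q xy that V Kq[of "fst a" "snd a"] Kq[of "fst b" "snd b"]
        unfolding sublinear_on_def by (auto intro: subspace_add)
      finally show ?thesis by simp
    qed
    then have "q' (x + y) - (q (y + fst b) - snd b) \<le> q' x" if "b \<in> K" for b
      using that by (intro ge) (simp add: algebra_simps)
    then have "q' (x + y) - q' x \<le> q' y"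
      by (intro ge) (simp add: algebra_simps)
    then show "q' (x + y) \<le> q' x + q' y" by simp
  next
    fix c :: real and x assume c: "c > 0" and x: "x \<in> V"
    have "q' (c *\<^sub>R x) / c \<le> q (x + fst a) - snd a" if "a \<in> K" for a
    proof -
      have xa: "x + fst a \<in> V" using x V Kq[of "fst a" "snd a"] that by (auto intro: subspace_add)
      have "q' (c *\<^sub>R x) \<le> q (c *\<^sub>R x + fst (c *\<^sub>R a)) - snd (c *\<^sub>R a)"
        using x c that V Kscale by (intro le) (auto intro: subspace_scale)
      also have "\<dots> = c * (q (x + fst a) - snd a)"
        using sublinear_on_scale[OF V q xa c] by (simp add: algebra_simps)
      finally show ?thesis using c by (simp add: field_simps)
    qed
    then have "q' (c *\<^sub>R x) / c \<le> q' x" by (rule ge)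
    then show "q' (c *\<^sub>R x) \<le> c * q' x" using c by (simp add: field_simps)
  qed
  with le_q neg show ?thesis by blast
qed

text \<open>Subadditivity survives the infimum because any two members of the chain lie above a
  common member, namely the smaller one. The common majorant \<open>p\<close> makes the infimum
  finite: every member is at least - p (- x) at x.\<close>

lemma sublinear_on_chain_inf:
  fixes V :: "'a::real_vector set"
  assumes V: "subspace V" and C: "C \<noteq> {}" "\<And>q. q \<in> C \<Longrightarrow> sublinear_on V q"
    and dom: "\<And>q x. q \<in> C \<Longrightarrow> x \<in> V \<Longrightarrow> q x \<le> p x"
    and tot: "\<And>q r. q \<in> C \<Longrightarrow> r \<in> C \<Longrightarrow> q \<le> r \<or> r \<le> q"
  shows "sublinear_on V (\<lambda>x. INF q\<in>C. q x)" "\<And>q x. q \<in> C \<Longrightarrow> x \<in> V \<Longrightarrow> (INF q\<in>C. q x) \<le> q x"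
proof -
  have bdd: "bdd_below ((\<lambda>q. q x) ` C)" if "x \<in> V" for x
  proof (rule bdd_belowI2)
    fix q assume "q \<in> C"
    then show "- p (- x) \<le> q x"
      using sublinear_on_ge[OF V C(2) that] dom[of q "- x"] subspace_neg[OF V that] by fastforce
  qed
  show le: "(INF q\<in>C. q x) \<le> q x" if "q \<in> C" "x \<in> V" for q x
    using that bdd by (intro cINF_lower) auto
  have ge: "b \<le> (INF q\<in>C. q x)" if "\<And>q. q \<in> C \<Longrightarrow> b \<le> q x" for b x
    using that C by (intro cINF_greatest) auto
  show "sublinear_on V (\<lambda>x. INF q\<in>C. q x)"
    unfolding sublinear_on_def
  proof (intro conjI ballI allI impI)
    have "q 0 = 0" if "q \<in> C" for q using C(2)[OF that] unfolding sublinear_on_def by blast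
    then have "(INF q\<in>C. q 0) = (INF q\<in>C. 0)" by (rule INF_cong[OF refl])
    then show "(INF q\<in>C. q 0) = 0" using C(1) by simp
  next
    fix x y assume xy: "x \<in> V" "y \<in> V"
    have "(INF q\<in>C. q (x + y)) \<le> q1 x + q2 y" if q12: "q1 \<in> C" "q2 \<in> C" for q1 q2
    proof -
      obtain q where q: "q \<in> C" "q \<le> q1" "q \<le> q2" using tot[OF q12] q12 by blast
      have "(INF q\<in>C. q (x + y)) \<le> q (x + y)" using q xy V by (intro le) (auto intro: subspace_add)
      also have "\<dots> \<le> q x + q y" using C(2)[OF q(1)] xy unfolding sublinear_on_def by blast
      also have "\<dots> \<le> q1 x + q2 y" using q by (intro add_mono) (auto simp: le_fun_def)
      finally show ?thesis .
    qed
    then have "(INF q\<in>C. q (x + y)) - q2 y \<le> (INF q\<in>C. q x)" if "q2 \<in> C" for q2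
      using that by (intro ge) (simp add: algebra_simps)
    then have "(INF q\<in>C. q (x + y)) - (INF q\<in>C. q x) \<le> (INF q\<in>C. q y)"
      by (intro ge) (simp add: algebra_simps)
    then show "(INF q\<in>C. q (x + y)) \<le> (INF q\<in>C. q x) + (INF q\<in>C. q y)" by simp
  next
    fix c :: real and x assume c: "c > 0" and x: "x \<in> V"
    have "(INF q\<in>C. q (c *\<^sub>R x)) / c \<le> q x" if "q \<in> C" for q
      using le[OF that subspace_scale[OF V x, of c]] sublinear_on_scale[OF V C(2)[OF that] x c] c
      by (simp add: field_simps)
    then have "(INF q\<in>C. q (c *\<^sub>R x)) / c \<le> (INF q\<in>C. q x)" by (rule ge)
    then show "(INF q\<in>C. q (c *\<^sub>R x)) \<le> c * (INF q\<in>C. q x)" using c by (simp add: field_simps)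
  qed
qed

text \<open>Hahn--Banach: a minimal sublinear functional is linear, since otherwise an inf-convolution
  with a ray would lower it further.\<close>

theorem sublinear_on_linear_minorant:
  fixes V :: "'a::real_vector set"
  assumes V: "subspace V" and p: "sublinear_on V p"
  obtains l where "\<And>x y. x \<in> V \<Longrightarrow> y \<in> V \<Longrightarrow> l (x + y) = l x + l y"
    "\<And>c x. x \<in> V \<Longrightarrow> l (c *\<^sub>R x) = c * l x" "\<And>x. x \<in> V \<Longrightarrow> l x \<le> p x"
proof -
  \<comment> \<open>The order is the pointwise one on the whole type. Fixing the value 0 outside
    \<open>V\<close> makes comparison and equality depend on the values in \<open>V\<close>
    alone.\<close>
  let ?cut = "\<lambda>q x. if x \<in> V then q x else (0::real)"
  define A where "A = {q. sublinear_on V q \<and> (\<forall>x\<in>V. q x \<le> p x) \<and> (\<forall>x. x \<notin> V \<longrightarrow> q x = 0)}"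
  have cut: "sublinear_on V (?cut q)" if "sublinear_on V q" for q
    using that V unfolding sublinear_on_def by (auto simp: subspace_add subspace_scale subspace_0)
  have "\<exists>m\<in>A. \<forall>a\<in>A. a \<le> m \<longrightarrow> a = m"
  proof (rule predicate_Zorn)
    show "partial_order_on A (relation_of (\<lambda>q r. r \<le> q) A)"
      by (rule partial_order_on_relation_ofI) auto
  next
    fix C assume "C \<in> Chains (relation_of (\<lambda>q r. r \<le> q) A)"
    then have CA: "C \<subseteq> A" and tot: "\<And>q r. q \<in> C \<Longrightarrow> r \<in> C \<Longrightarrow> q \<le> r \<or> r \<le> q"
      unfolding Chains_def relation_of_def by auto
    show "\<exists>u\<in>A. \<forall>a\<in>C. u \<le> a"
    proof (cases "C = {}")
      case True
      have "?cut p \<in> A" using cut[OF p] unfolding A_def by auto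
      with True show ?thesis by blast
    next
      case False
      let ?u = "?cut (\<lambda>x. INF q\<in>C. q x)"
      have 1: "sublinear_on V q" "\<forall>x\<in>V. q x \<le> p x" "\<forall>x. x \<notin> V \<longrightarrow> q x = 0" if "q \<in> C" for q
        using that CA unfolding A_def by auto
      have 2: "sublinear_on V (\<lambda>x. INF q\<in>C. q x)"
        and 3: "\<And>q x. q \<in> C \<Longrightarrow> x \<in> V \<Longrightarrow> (INF q\<in>C. q x) \<le> q x"
        using sublinear_on_chain_inf[OF V False, of p] 1 tot by blast+
      have "?u \<in> A" unfolding A_def
        using cut[OF 2] False 1(2) 3 by (auto) (meson order_trans ex_in_conv)
      moreover have "?u \<le> a" if "a \<in> C" for a
        using 3[OF that] 1(3)[OF that] by (auto simp: le_fun_def)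
      ultimately show ?thesis by blast
    qed
  qed
  then obtain l where l: "l \<in> A" and min: "\<And>a. a \<in> A \<Longrightarrow> a \<le> l \<Longrightarrow> a = l" by blast
  have lsub: "sublinear_on V l" and lp: "\<And>x. x \<in> V \<Longrightarrow> l x \<le> p x" and lout: "\<And>x. x \<notin> V \<Longrightarrow> l x = 0"
    using l unfolding A_def by auto
  have odd: "l (- x) = - l x" if x: "x \<in> V" for x
  proof -
    \<comment> \<open>The ray through (x, l x). The lowered functional is at most - l x at - x, but
      by minimality it agrees with \<open>l\<close> on \<open>V\<close>; hence l (- x) \<le> - l x.
      The reverse inequality is subadditivity.\<close>
    let ?K = "(\<lambda>t. (t *\<^sub>R x, t * l x)) ` {0..}"
    have "\<exists>q'. sublinear_on V q' \<and> (\<forall>x\<in>V. q' x \<le> l x) \<and> (\<forall>(k, s)\<in>?K. q' (- k) \<le> - s)"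
    proof (rule sublinear_on_inf_convolution[OF V lsub])
      show "(0, 0) \<in> ?K" by (rule image_eqI[of _ _ 0]) auto
      show "a + b \<in> ?K" if ab: "a \<in> ?K" "b \<in> ?K" for a b
      proof -
        obtain s t where "s \<ge> 0" "t \<ge> 0" "a = (s *\<^sub>R x, s * l x)" "b = (t *\<^sub>R x, t * l x)" using ab by auto
        then show ?thesis by (intro image_eqI[of _ _ "s + t"]) (auto simp: algebra_simps)
      qed
      show "c *\<^sub>R a \<in> ?K" if "c > 0" and a: "a \<in> ?K" for c a
      proof -
        obtain s where "s \<ge> 0" "a = (s *\<^sub>R x, s * l x)" using a by auto
        then show ?thesis using \<open>c > 0\<close> by (intro image_eqI[of _ _ "c * s"]) (auto simp: algebra_simps)
      qed
      show "k \<in> V \<and> s \<le> l k" if ks: "(k, s) \<in> ?K" for k s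
      proof -
        obtain t where t: "t \<ge> 0" "k = t *\<^sub>R x" "s = t * l x" using ks by auto
        then have "s \<le> l k"
          using sublinear_on_scale[OF V lsub x, of t] lsub unfolding sublinear_on_def
          by (cases "t = 0") auto
        then show ?thesis using t x V by (auto intro: subspace_scale)
      qed
    qed
    then obtain q' where q': "sublinear_on V q'" "\<And>x. x \<in> V \<Longrightarrow> q' x \<le> l x"
      and le: "\<And>k s. (k, s) \<in> ?K \<Longrightarrow> q' (- k) \<le> - s" by blast
    have "?cut q' \<in> A" unfolding A_def using cut[OF q'(1)] q'(2) lp order_trans by auto blast
    moreover have "?cut q' \<le> l" using q'(2) lout by (auto simp: le_fun_def)
    ultimately have "?cut q' = l" by (rule min)
    then have "?cut q' (- x) = l (- x)" by (rule fun_cong)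
    then have "l (- x) = q' (- x)" using subspace_neg[OF V x] by simp
    moreover have "(x, l x) \<in> ?K" by (rule image_eqI[of _ _ 1]) auto
    ultimately have "l (- x) \<le> - l x" using le by simp
    then show ?thesis using sublinear_on_ge[OF V lsub x] by simp
  qed
  show ?thesis
  proof
    show "l (x + y) = l x + l y" if "x \<in> V" "y \<in> V" for x y
    proof (rule antisym)
      have *: "l (a + b) \<le> l a + l b" if "a \<in> V" "b \<in> V" for a b
        using that lsub unfolding sublinear_on_def by blast
      show "l (x + y) \<le> l x + l y" using * that by blast
      \<comment> \<open>Oddness turns subadditivity at the negated arguments into
        superadditivity.\<close>
      have "l (- x + - y) \<le> l (- x) + l (- y)" using * that V subspace_neg by blast
      moreover have "- x + - y = - (x + y)" by simp
      ultimately show "l x + l y \<le> l (x + y)"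
        using odd that subspace_add[OF V] by fastforce
    qed
    show "l (c *\<^sub>R x) = c * l x" if "x \<in> V" for c x
    proof -
      consider "c = 0" | "c > 0" | "c < 0" by linarith
      then show ?thesis
      proof cases
        case 1 then show ?thesis using lsub unfolding sublinear_on_def by simp
      next
        case 2 then show ?thesis using sublinear_on_scale[OF V lsub that] by blast
      next
        case 3
        then have "l ((- c) *\<^sub>R x) = - c * l x" using sublinear_on_scale[OF V lsub that, of "- c"] by simp
        then show ?thesis using odd[OF subspace_scale[OF V that, of c]] by simp
      qed
    qed
    show "l x \<le> p x" if "x \<in> V" for x using lp that .
  qed
qed

section \<open>Separating a point from a convex set at positive seminorm distance\<close>

definition seminorm_on :: "'a::real_vector set \<Rightarrow> ('a \<Rightarrow> real) \<Rightarrow> bool" where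
  "seminorm_on V N \<longleftrightarrow> (\<forall>x\<in>V. \<forall>y\<in>V. N (x + y) \<le> N x + N y) \<and> (\<forall>c. \<forall>x\<in>V. N (c *\<^sub>R x) = \<bar>c\<bar> * N x)"

lemma seminorm_on_simps:
  assumes "subspace V" "seminorm_on V N"
  shows "N 0 = 0" "x \<in> V \<Longrightarrow> N (- x) = N x"
proof -
  show N0: "N 0 = 0" using assms subspace_0[of V] unfolding seminorm_on_def by (metis abs_zero mult_zero_left scaleR_zero_left)
  show neg: "N (- x) = N x" if "x \<in> V" for x
  proof -
    have "N ((-1) *\<^sub>R x) = \<bar>-1\<bar> * N x" using assms that unfolding seminorm_on_def by blast
    then show ?thesis by simp
  qed
qed

text \<open>Hahn--Banach is applied to the infimum of \<open>N (x + t (u - c)) - t d\<close> over \<open>t \<ge> 0\<close> and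
  \<open>c \<in> C\<close>: by convexity of \<open>C\<close> the pairs \<open>(t (u - c), t d)\<close> form a convex cone.\<close>

theorem seminorm_separation:
  fixes V :: "'a::real_vector set"
  assumes V: "subspace V" and N: "seminorm_on V N"
    and C: "C \<subseteq> V" "convex C" "C \<noteq> {}" and u: "u \<in> V" and dist: "\<forall>c\<in>C. d \<le> N (u - c)"
  obtains l where "\<And>x y. x \<in> V \<Longrightarrow> y \<in> V \<Longrightarrow> l (x + y) = l x + l y"
    "\<And>c x. x \<in> V \<Longrightarrow> l (c *\<^sub>R x) = c * l x" "\<And>x. x \<in> V \<Longrightarrow> \<bar>l x\<bar> \<le> N x"
    "\<And>c. c \<in> C \<Longrightarrow> l c \<le> l u - d"
proof -
  let ?K = "{(t *\<^sub>R (u - c), t * d) |t c. t \<ge> 0 \<and> c \<in> C}"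
  have sub: "sublinear_on V N"
    using seminorm_on_simps[OF V N] N unfolding sublinear_on_def seminorm_on_def by auto
  have "\<exists>q'. sublinear_on V q' \<and> (\<forall>x\<in>V. q' x \<le> N x) \<and> (\<forall>(k, s)\<in>?K. q' (- k) \<le> - s)"
  proof (rule sublinear_on_inf_convolution[OF V sub])
    obtain c where "c \<in> C" using C by blast
    then show "(0, 0) \<in> ?K" by (auto intro!: exI[of _ "0::real"])
    show "a + b \<in> ?K" if ab: "a \<in> ?K" "b \<in> ?K" for a b
    proof -
      obtain s c t e where *: "s \<ge> 0" "t \<ge> 0" "c \<in> C" "e \<in> C"
        "a = (s *\<^sub>R (u - c), s * d)" "b = (t *\<^sub>R (u - e), t * d)" using ab by auto
      show ?thesis
      proof (cases "s + t = 0")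
        case True
        then have "s = 0" "t = 0" using * by auto
        then show ?thesis using * by (auto intro!: exI[of _ "0::real"])
      next
        case False
        then have pos: "s + t > 0" using * by auto
        \<comment> \<open>Two rays combine into one: the weighted mean of c and e is again in
          \<open>C\<close>, and its multiple by s + t recovers the sum. Vanishing s + t was split
          off to permit the division.\<close>
        let ?g = "(s / (s + t)) *\<^sub>R c + (t / (s + t)) *\<^sub>R e"
        have "?g \<in> C" using C(2) * pos by (intro convexD) (auto simp: add_divide_distrib[symmetric])
        moreover have "(s + t) *\<^sub>R (u - ?g) = s *\<^sub>R (u - c) + t *\<^sub>R (u - e)"
        proof -
          have "(s + t) *\<^sub>R ?g = s *\<^sub>R c + t *\<^sub>R e" using pos by (simp add: scaleR_add_right)
          then show ?thesis by (simp add: scaleR_diff_right scaleR_add_left)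
        qed
        moreover have "a + b = (s *\<^sub>R (u - c) + t *\<^sub>R (u - e), (s + t) * d)"
          using * by (simp add: distrib_right)
        ultimately have "a + b = ((s + t) *\<^sub>R (u - ?g), (s + t) * d) \<and> s + t \<ge> 0 \<and> ?g \<in> C"
          using pos by simp
        then show ?thesis by blast
      qed
    qed
    show "c *\<^sub>R a \<in> ?K" if "c > 0" and a: "a \<in> ?K" for c a
    proof -
      obtain s e where "s \<ge> 0" "e \<in> C" "a = (s *\<^sub>R (u - e), s * d)" using a by auto
      then show ?thesis using \<open>c > 0\<close> by (auto intro!: exI[of _ "c * s"] exI[of _ e])
    qed
    \<comment> \<open>The distance hypothesis enters here: t * d \<le> t * N (u - c) = N k, so the
      demands are compatible with the seminorm.\<close>
    show "k \<in> V \<and> s \<le> N k" if ks: "(k, s) \<in> ?K" for k s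
    proof -
      obtain t c where t: "t \<ge> 0" "c \<in> C" "k = t *\<^sub>R (u - c)" "s = t * d" using ks by auto
      have uc: "u - c \<in> V" using t C u V subspace_diff by blast
      then have "N k = t * N (u - c)" using N t unfolding seminorm_on_def by simp
      then show ?thesis using t uc V bspec[OF dist t(2)] by (auto intro: subspace_scale mult_left_mono)
    qed
  qed
  then obtain q' where q': "sublinear_on V q'" "\<And>x. x \<in> V \<Longrightarrow> q' x \<le> N x"
    and le: "\<And>k s. (k, s) \<in> ?K \<Longrightarrow> q' (- k) \<le> - s" by blast
  obtain l where l: "\<And>x y. x \<in> V \<Longrightarrow> y \<in> V \<Longrightarrow> l (x + y) = l x + l y"
    "\<And>c x. x \<in> V \<Longrightarrow> l (c *\<^sub>R x) = c * l x" "\<And>x. x \<in> V \<Longrightarrow> l x \<le> q' x"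
    using sublinear_on_linear_minorant[OF V q'(1)] by blast
  have lneg: "l (- x) = - l x" if "x \<in> V" for x using l(2)[OF that, of "-1"] by simp
  show ?thesis
  proof
    show "\<bar>l x\<bar> \<le> N x" if "x \<in> V" for x
      using l(3)[OF that] l(3)[OF subspace_neg[OF V that]] q'(2)[OF that] q'(2)[OF subspace_neg[OF V that]]
        lneg[OF that] seminorm_on_simps(2)[OF V N that] by linarith
    show "l c \<le> l u - d" if "c \<in> C" for c
    proof -
      have uc: "u - c \<in> V" "c \<in> V" "- u \<in> V" using that C u V subspace_diff subspace_neg by blast+
      have "(u - c, d) \<in> ?K" using that by (auto intro!: exI[of _ "1::real"])
      then have "q' (- (u - c)) \<le> - d" by (rule le)
      then have "l (- (u - c)) \<le> - d" using l(3)[OF subspace_neg[OF V uc(1)]] by linarith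
      moreover have "l (- (u - c)) = l c - l u"
        using l(1)[OF uc(2,3)] lneg[OF u] by simp
      ultimately show ?thesis by simp
    qed
  qed (use l in auto)
qed


section \<open>Test functions\<close>

lemma partial_eqI:
  assumes "(g has_derivative g') (at \<xi>)"
  shows "partial i g \<xi> = g' (axis i 1)"
  using frechet_derivative_at[OF assms] by (simp add: partial_def)

lemma partial_const [simp]: "partial i (\<lambda>x. c) = (\<lambda>x. 0)"
  by (rule ext) (rule partial_eqI[where g' = "\<lambda>_. 0"], simp)

lemma partial_add:
  assumes "\<And>x. f differentiable (at x)" "\<And>x. g differentiable (at x)"
  shows "partial i (\<lambda>x. f x + g x) = (\<lambda>x. partial i f x + partial i g x)"
proof
  fix x
  show "partial i (\<lambda>x. f x + g x) x = partial i f x + partial i g x"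
    using partial_eqI[OF has_derivative_add[OF assms[of x, unfolded frechet_derivative_works]]]
    by (simp add: partial_def)
qed

lemma partial_mult:
  assumes "\<And>x. f differentiable (at x)" "\<And>x. g differentiable (at x)"
  shows "partial i (\<lambda>x. f x * g x) = (\<lambda>x. f x * partial i g x + partial i f x * g x)"
proof
  fix x
  show "partial i (\<lambda>x. f x * g x) x = f x * partial i g x + partial i f x * g x"
    using partial_eqI[OF has_derivative_mult[OF assms[of x, unfolded frechet_derivative_works]]]
    by (simp add: partial_def)
qed

text \<open>Needed for products: the product rule multiplies a derivative, which is smooth only to
  the lower order, by an undifferentiated factor that must be brought down to the same
  order.\<close>

lemma C_k_Suc_imp: "C_k (Suc k) f \<Longrightarrow> C_k k f"
proof (induction k arbitrary: f)
  case 0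
  then show ?case by (simp add: continuous_at_imp_continuous_on differentiable_imp_continuous_within)
next
  case (Suc k)
  then show ?case using C_k.simps(2) by blast
qed

lemma C_k_const: "C_k k (\<lambda>x. c)"
  by (induction k arbitrary: c) auto

lemma C_k_add: "C_k k f \<Longrightarrow> C_k k g \<Longrightarrow> C_k k (\<lambda>x. f x + g x)"
proof (induction k arbitrary: f g)
  case 0
  then show ?case by (simp add: continuous_on_add)
next
  case (Suc k)
  then show ?case by (simp add: partial_add differentiable_add)
qed

lemma C_k_mult: "C_k k f \<Longrightarrow> C_k k g \<Longrightarrow> C_k k (\<lambda>x. f x * g x)"
proof (induction k arbitrary: f g)
  case 0
  then show ?case by (simp add: continuous_on_mult)
next
  case (Suc k)
  have "C_k k f" "C_k k g" using Suc.prems C_k_Suc_imp by blast+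
  with Suc show ?case by (simp add: partial_mult differentiable_mult C_k_add)
qed

lemma C_k_prod: "(\<And>i. i \<in> I \<Longrightarrow> C_k k (f i)) \<Longrightarrow> C_k k (\<lambda>x. \<Prod>i\<in>I. f i x)"
  by (induction I rule: infinite_finite_induct) (auto intro: C_k_const C_k_mult)

text \<open>For fixed \<open>c\<close> the span of this family is closed under differentiation, hence consists of smooth
  functions; as \<open>c\<close> tends to zero, \<open>flat c 0\<close> tends to the indicator of the positive half-line.\<close>

definition flat :: "real \<Rightarrow> nat \<Rightarrow> real \<Rightarrow> real" where
  "flat c m t = (if t > 0 then exp (- c / t) / t ^ m else 0)"

text \<open>The two terms come from differentiating the exponential and the power. Only the origin
  needs a limit: there the right difference quotient is exp (- c / h) / h ^ (m + 1), and the
  exponential beats every power.\<close>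

lemma flat_has_real_derivative:
  assumes c: "c > 0"
  shows "(flat c m has_real_derivative c * flat c (m + 2) t - real m * flat c (m + 1) t) (at t)"
proof -
  consider "t > 0" | "t < 0" | "t = 0" by linarith
  then show ?thesis
  proof cases
    case 1
    have "((\<lambda>t. exp (- c / t) / t ^ m) has_real_derivative
        c * flat c (m + 2) t - real m * flat c (m + 1) t) (at t)"
    proof -
      \<comment> \<open>The truncated exponent m - 1 is harmless for m = 0, where the factor m
        vanishes.\<close>
      have *: "real m * t ^ (m - 1) = real m * t ^ m / t" using 1 by (cases m) auto
      have "((\<lambda>t. exp (- c / t) * inverse (t ^ m)) has_real_derivative
          exp (- c / t) * (c / t\<^sup>2) * inverse (t ^ m) +
          exp (- c / t) * (- (real m * t ^ (m - 1)) / (t ^ m)\<^sup>2)) (at t)"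
        using 1 by (auto intro!: derivative_eq_intros simp: power2_eq_square field_simps)
      then show ?thesis
        unfolding * using 1 by (simp add: flat_def field_simps power2_eq_square)
    qed
    then show ?thesis
      by (rule has_field_derivative_transform_within_open[of _ _ _ "{0<..}"]) (use 1 in \<open>auto simp: flat_def\<close>)
  next
    case 2
    have "((\<lambda>t. 0) has_real_derivative c * flat c (m + 2) t - real m * flat c (m + 1) t) (at t)"
      using 2 by (auto simp: flat_def)
    then show ?thesis
      by (rule has_field_derivative_transform_within_open[of _ _ _ "{..<0}"]) (use 2 in \<open>auto simp: flat_def\<close>)
  next
    case 3
    have "((\<lambda>h. exp (- c / h) / h ^ Suc m) \<longlongrightarrow> 0) (at_right 0)"
    proof -
      have "filterlim (\<lambda>h. c / h) at_top (at_right (0::real))"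
        unfolding divide_inverse
        by (rule filterlim_tendsto_pos_mult_at_top[OF tendsto_const c filterlim_inverse_at_top_right])
      \<comment> \<open>With y = c / h tending to infinity this is y ^ (m + 1) / exp y; the factor c
        ^ (m + 1) is divided out afterwards.\<close>
      then have "((\<lambda>h. (c / h) ^ Suc m / exp (c / h)) \<longlongrightarrow> 0) (at_right 0)"
        by (rule filterlim_compose[OF tendsto_power_div_exp_0])
      then have "((\<lambda>h. inverse (c ^ Suc m) * ((c / h) ^ Suc m / exp (c / h))) \<longlongrightarrow> 0) (at_right 0)"
        by (rule tendsto_mult_right_zero)
      then show ?thesis
        using c by (simp add: power_divide exp_minus field_simps)
    qed
    then have "((\<lambda>h. flat c m h / h) \<longlongrightarrow> 0) (at_right 0)"
      by (rule Lim_transform_eventually) (auto simp: eventually_at_filter flat_def field_simps)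
    moreover have "((\<lambda>h. flat c m h / h) \<longlongrightarrow> 0) (at_left 0)"
      by (rule Lim_transform_eventually[OF tendsto_const]) (auto simp: eventually_at_filter flat_def)
    ultimately have "((\<lambda>h. flat c m h / h) \<longlongrightarrow> 0) (at 0)"
      by (simp add: filterlim_split_at)
    then show ?thesis using 3 by (simp add: has_field_derivative_iff flat_def)
  qed
qed

text \<open>Differentiation raises the index by one or two, so the induction runs over all
  \<open>m\<close> simultaneously. The affine argument covers both slopes, 1 and -1, used for the
  lower and upper faces of a box.\<close>

lemma C_k_flat:
  fixes i :: "'n::finite"
  assumes c: "c > 0"
  shows "C_k k (\<lambda>x::real^'n. flat c m (a * x $ i + b))"
proof (induction k arbitrary: m)
  case 0
  have "continuous_on UNIV (flat c m)"
    using flat_has_real_derivative[OF c]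
    by (meson DERIV_isCont continuous_at_imp_continuous_on)
  then have "continuous_on UNIV (flat c m \<circ> (\<lambda>x::real^'n. a * x $ i + b))"
    by (intro continuous_on_compose continuous_intros) (auto intro: continuous_on_subset)
  then show ?case by (simp add: o_def)
next
  case (Suc k)
  let ?d = "\<lambda>m t. c * flat c (m + 2) t - real m * flat c (m + 1) t"
  have der: "((\<lambda>x::real^'n. flat c m (a * x $ i + b)) has_derivative
      (\<lambda>h. ?d m (a * x $ i + b) * (a * h $ i))) (at x)" for x
  proof -
    have "((\<lambda>x::real^'n. a * x $ i + b) has_derivative (\<lambda>h. a * h $ i)) (at x)"
      by (auto intro!: derivative_eq_intros bounded_linear.has_derivative[OF bounded_linear_vec_nth])
    from has_derivative_compose[OF this flat_has_real_derivative[OF c, unfolded has_field_derivative_def]]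
    show ?thesis by simp
  qed
  have "partial j (\<lambda>x::real^'n. flat c m (a * x $ i + b)) =
      (\<lambda>x. c * (a * axis j 1 $ i) * flat c (m + 2) (a * x $ i + b) +
           (- real m * (a * axis j 1 $ i)) * flat c (m + 1) (a * x $ i + b))" for j
    by (rule ext, subst partial_eqI[OF der]) (simp add: algebra_simps)
  moreover have "(\<lambda>x::real^'n. flat c m (a * x $ i + b)) differentiable at x" for x
    using der by (auto simp: differentiable_def)
  moreover have "C_k k (\<lambda>x. c * (a * axis j 1 $ i) * flat c (m + 2) (a * x $ i + b) +
      (- real m * (a * axis j 1 $ i)) * flat c (m + 1) (a * x $ i + b))" for j
    by (intro C_k_add C_k_mult[OF C_k_const] Suc.IH)
  ultimately show ?case by (simp only: C_k.simps) simp
qed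

section \<open>Test functions: support, closure properties and bumps on boxes\<close>

lemma test_functionsI:
  assumes "\<And>k. C_k k \<phi>" "compact K" "K \<subseteq> \<Omega>" "\<And>x. x \<notin> K \<Longrightarrow> \<phi> x = 0"
  shows "\<phi> \<in> test_functions \<Omega>"
proof -
  have "closure {x. \<phi> x \<noteq> 0} \<subseteq> K"
    using assms compact_imp_closed by (intro closure_minimal) auto
  moreover have "compact (closure {x. \<phi> x \<noteq> 0})"
    using calculation assms(2) by (meson closed_closure compact_closure closure_subset compact_imp_bounded bounded_subset)
  ultimately show ?thesis using assms unfolding test_functions_def by auto
qed

text \<open>The complement of the support is open, so near any of its points the function is
  constantly zero; its derivatives thus vanish off the same compact set.\<close>

lemma test_functionsE:
  assumes "\<phi> \<in> test_functions \<Omega>"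
  obtains K where "compact K" "K \<subseteq> \<Omega>" "\<And>x. x \<notin> K \<Longrightarrow> \<phi> x = 0" "\<And>i x. x \<notin> K \<Longrightarrow> partial i \<phi> x = 0"
proof
  let ?K = "closure {x. \<phi> x \<noteq> 0}"
  show "compact ?K" "?K \<subseteq> \<Omega>" using assms unfolding test_functions_def by auto
  show 0: "\<phi> x = 0" if "x \<notin> ?K" for x using that closure_subset[of "{x. \<phi> x \<noteq> 0}"] by auto
  show "partial i \<phi> x = 0" if "x \<notin> ?K" for i x
  proof -
    have "((\<lambda>x. 0) has_derivative (\<lambda>h. 0)) (at x)" by simp
    then have "(\<phi> has_derivative (\<lambda>h. 0)) (at x)"
    proof (rule has_derivative_transform_within_open)
      show "open (- ?K)" "x \<in> - ?K" using that by auto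
      show "0 = \<phi> y" if "y \<in> - ?K" for y using 0[of y] that by simp
    qed
    then show ?thesis by (rule partial_eqI)
  qed
qed

lemma test_functions_C_k: "\<phi> \<in> test_functions \<Omega> \<Longrightarrow> C_k k \<phi>"
  unfolding test_functions_def by simp

lemma test_functions_differentiable: "\<phi> \<in> test_functions \<Omega> \<Longrightarrow> \<phi> differentiable (at x)"
  using test_functions_C_k[of \<phi> \<Omega> 1] by simp

lemma test_functions_continuous: "\<phi> \<in> test_functions \<Omega> \<Longrightarrow> continuous_on UNIV \<phi>"
  using test_functions_C_k[of \<phi> \<Omega> 0] by simp

lemma test_functions_partial: "\<phi> \<in> test_functions \<Omega> \<Longrightarrow> partial i \<phi> \<in> test_functions \<Omega>"
proof -
  assume \<phi>: "\<phi> \<in> test_functions \<Omega>"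
  obtain K where K: "compact K" "K \<subseteq> \<Omega>"
      "\<And>x. x \<notin> K \<Longrightarrow> \<phi> x = 0" "\<And>i x. x \<notin> K \<Longrightarrow> partial i \<phi> x = 0"
    by (rule test_functionsE[OF \<phi>]) blast
  have "C_k k (partial i \<phi>)" for k using test_functions_C_k[OF \<phi>, of "Suc k"] by simp
  then show ?thesis using K by (intro test_functionsI) auto
qed

lemma test_functions_lincomb:
  assumes "\<phi> \<in> test_functions \<Omega>" "\<eta> \<in> test_functions \<Omega>"
  shows "(\<lambda>x. a * \<phi> x + b * \<eta> x) \<in> test_functions \<Omega>"
proof -
  obtain K where K: "compact K" "K \<subseteq> \<Omega>"
      "\<And>x. x \<notin> K \<Longrightarrow> \<phi> x = 0"
    by (rule test_functionsE[OF assms(1)]) blast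
  obtain L where L: "compact L" "L \<subseteq> \<Omega>"
      "\<And>x. x \<notin> L \<Longrightarrow> \<eta> x = 0"
    by (rule test_functionsE[OF assms(2)]) blast
  show ?thesis
    using K L assms by (intro test_functionsI[of _ "K \<union> L"])
      (auto intro!: C_k_add C_k_mult C_k_const compact_Un dest: test_functions_C_k)
qed

lemma test_functions_mult:
  assumes "\<phi> \<in> test_functions \<Omega>" "\<And>k. C_k k \<eta>"
  shows "(\<lambda>x. \<phi> x * \<eta> x) \<in> test_functions \<Omega>"
proof -
  obtain K where K: "compact K" "K \<subseteq> \<Omega>"
      "\<And>x. x \<notin> K \<Longrightarrow> \<phi> x = 0"
    by (rule test_functionsE[OF assms(1)]) blast
  show ?thesis
    using K assms by (intro test_functionsI[of _ K])
      (auto intro!: C_k_mult C_k_const dest: test_functions_C_k)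
qed

text \<open>One factor per face of the box: the product is positive exactly on the open box when
  \<open>c\<close> is positive, and its values lie between 0 and 1, which later gives a dominating
  function.\<close>

definition bump :: "real^'n::finite \<Rightarrow> real^'n \<Rightarrow> real \<Rightarrow> real^'n \<Rightarrow> real" where
  "bump a b c x = (\<Prod>i\<in>UNIV. flat c 0 (x $ i - a $ i) * flat c 0 (b $ i - x $ i))"

lemma bump_eq_0: "x \<notin> box a b \<Longrightarrow> bump a b c x = 0"
  by (force simp: bump_def mem_box_cart flat_def)

lemma bump_test_function:
  assumes "c > 0" "cbox a b \<subseteq> \<Omega>"
  shows "bump a b c \<in> test_functions \<Omega>"
proof (rule test_functionsI)
  have 1: "C_k k (\<lambda>x. flat c 0 (x $ i - a $ i))" for k i
    using C_k_flat[OF assms(1), of k 0 1 i "- a $ i"] by simp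
  have 2: "C_k k (\<lambda>x. flat c 0 (b $ i - x $ i))" for k i
    using C_k_flat[OF assms(1), of k 0 "-1" i "b $ i"] by simp
  show "C_k k (bump a b c)" for k
    unfolding bump_def[abs_def] by (intro C_k_prod C_k_mult 1 2)
  show "compact (cbox a b)" by (rule compact_cbox)
  show "bump a b c x = 0" if "x \<notin> cbox a b" for x
    using bump_eq_0 box_subset_cbox that by blast
qed (fact assms)

lemma bump_bounds:
  assumes "c > 0"
  shows "0 \<le> bump a b c x" "bump a b c x \<le> 1"
proof -
  have f: "0 \<le> flat c 0 t \<and> flat c 0 t \<le> 1" for t using assms by (simp add: flat_def)
  show "0 \<le> bump a b c x" unfolding bump_def using f by (intro prod_nonneg) auto
  show "bump a b c x \<le> 1" unfolding bump_def using f by (intro prod_le_1) (auto intro: mult_le_one)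
qed

lemma bump_tendsto_indicator:
  fixes x :: "real^'n"
  shows "(\<lambda>k. bump a b (inverse (real (Suc k))) x) \<longlonglongrightarrow> indicator (box a b) x"
proof (cases "x \<in> box a b")
  case True
  have f: "(\<lambda>k. flat (inverse (real (Suc k))) 0 t) \<longlonglongrightarrow> 1" if "t > 0" for t
  proof -
    have "(\<lambda>k. exp (- inverse (real (Suc k)) / t)) \<longlonglongrightarrow> exp (- 0 / t)"
      by (intro tendsto_intros LIMSEQ_inverse_real_of_nat) (use that in auto)
    then show ?thesis using that by (simp add: flat_def)
  qed
  have "(\<lambda>k. bump a b (inverse (real (Suc k))) x) \<longlonglongrightarrow> (\<Prod>i\<in>(UNIV::'n set). 1 * 1)"
    unfolding bump_def by (intro tendsto_prod tendsto_mult f) (use True in \<open>auto simp: mem_box_cart\<close>)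
  then show ?thesis using True by simp
next
  case False
  then show ?thesis by (simp add: bump_eq_0)
qed


section \<open>The fundamental lemma of the calculus of variations\<close>

lemma borel_measurable_lebesgue_on_continuous:
  fixes g :: "'a::euclidean_space \<Rightarrow> 'b::topological_space"
  assumes "continuous_on UNIV g"
  shows "g \<in> borel_measurable (lebesgue_on S)"
  using assms by (intro measurable_restrict_space1 measurable_completion)
    (simp add: borel_measurable_continuous_onI)

lemma integrable_lebesgue_on_support:
  fixes f :: "'a::euclidean_space \<Rightarrow> 'b::euclidean_space"
  assumes "S \<in> sets lebesgue" "T \<in> sets lebesgue" "\<And>x. x \<notin> S \<inter> T \<Longrightarrow> f x = 0"
    and "integrable (lebesgue_on S) f"
  shows "integrable (lebesgue_on T) f"
proof -
  have "(\<lambda>x. indicator T x *\<^sub>R f x) = (\<lambda>x. indicator S x *\<^sub>R f x)"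
    using assms(3) by (force simp: indicator_def)
  then show ?thesis using assms by (simp add: integrable_restrict_space)
qed

lemma Lp_loc_1_iff:
  "g \<in> Lp_loc \<Omega> 1 \<longleftrightarrow> (\<forall>K. compact K \<and> K \<subseteq> \<Omega> \<longrightarrow> integrable (lebesgue_on K) g)"
proof -
  have "g \<in> Lp K 1 \<longleftrightarrow> integrable (lebesgue_on K) g" for K
    using integrable_norm_iff[of g "lebesgue_on K"] by (auto simp: Lp_def)
  then show ?thesis by (simp add: Lp_loc_def)
qed

lemma test_functions_bounded:
  assumes "\<phi> \<in> test_functions \<Omega>"
  obtains B where "\<And>x. \<bar>\<phi> x\<bar> \<le> B" "B > 0"
proof -
  obtain K where K: "compact K" "\<And>x. x \<notin> K \<Longrightarrow> \<phi> x = 0"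
    by (rule test_functionsE[OF assms]) blast
  have "compact (\<phi> ` K)"
    using K test_functions_continuous[OF assms] by (blast intro: compact_continuous_image continuous_on_subset)
  then obtain B where "B > 0" "\<forall>y\<in>\<phi> ` K. norm y \<le> B"
    using bounded_pos compact_imp_bounded by blast
  then show ?thesis using that K by (metis abs_zero imageI less_imp_le real_norm_def)
qed

lemma integrable_mult_test_function:
  fixes g :: "real^'n::finite \<Rightarrow> real"
  assumes \<Omega>: "\<Omega> \<in> sets lebesgue" and g: "g \<in> Lp_loc \<Omega> 1" and \<phi>: "\<phi> \<in> test_functions \<Omega>"
  shows "integrable (lebesgue_on \<Omega>) (\<lambda>x. g x * \<phi> x)"
proof -
  obtain K where K: "compact K" "K \<subseteq> \<Omega>" "\<And>x. x \<notin> K \<Longrightarrow> \<phi> x = 0"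
    by (rule test_functionsE[OF \<phi>]) blast
  obtain B where B: "\<And>x. \<bar>\<phi> x\<bar> \<le> B" by (rule test_functions_bounded[OF \<phi>]) blast
  have gK: "integrable (lebesgue_on K) g" using g K by (simp add: Lp_loc_1_iff)
  have [measurable]: "\<phi> \<in> borel_measurable (lebesgue_on K)"
    using test_functions_continuous[OF \<phi>] by (rule borel_measurable_lebesgue_on_continuous)
  have [measurable]: "g \<in> borel_measurable (lebesgue_on K)" using gK by simp
  have "integrable (lebesgue_on K) (\<lambda>x. g x * \<phi> x)"
  proof (rule Bochner_Integration.integrable_bound)
    show "integrable (lebesgue_on K) (\<lambda>x. B * g x)" using gK by simp
    have "\<bar>g x * \<phi> x\<bar> \<le> \<bar>B * g x\<bar>" for x
      using mult_right_mono[OF B[of x], of "\<bar>g x\<bar>"] B[of x] by (simp add: abs_mult mult.commute)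
    then show "AE x in lebesgue_on K. norm (g x * \<phi> x) \<le> norm (B * g x)" by simp
  qed measurable
  then show ?thesis
    using K \<Omega> by (intro integrable_lebesgue_on_support[of K \<Omega>]) (auto simp: lmeasurable_compact fmeasurableD)
qed

text \<open>Bumps on the box are admissible test functions and converge to the indicator of the open
  box. Since the closed box is a compact subset of \<open>\<Omega>\<close>, \<open>g\<close> is
  integrable there and dominates the products, so the limit may be taken under the integral.\<close>

lemma integral_box_eq_0:
  fixes g :: "real^'n::finite \<Rightarrow> real"
  assumes \<Omega>: "\<Omega> \<in> sets lebesgue" and g: "g \<in> Lp_loc \<Omega> 1"
    and zero: "\<And>\<phi>. \<phi> \<in> test_functions \<Omega> \<Longrightarrow> (LINT x|lebesgue_on \<Omega>. g x * \<phi> x) = 0"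
    and ab: "cbox a b \<subseteq> \<Omega>"
  shows "integrable lebesgue (\<lambda>x. indicator (cbox a b) x * g x)"
    and "(LINT x|lebesgue. indicator (box a b) x * g x) = 0"
proof -
  have "integrable (lebesgue_on (cbox a b)) g" using g ab by (simp add: Lp_loc_1_iff)
  then show int: "integrable lebesgue (\<lambda>x. indicator (cbox a b) x * g x)"
    by (simp add: integrable_restrict_space)
  then have [measurable]: "(\<lambda>x. indicator (cbox a b) x * g x) \<in> borel_measurable lebesgue" by simp
  let ?c = "\<lambda>k. inverse (real (Suc k))"
  have c: "?c k > 0" for k by simp
  \<comment> \<open>Each bump carries a redundant indicator of the closed box, which lets the domain
    of integration change from \<open>\<Omega>\<close> to the whole space.\<close>
  have supp: "bump a b (?c k) x = bump a b (?c k) x * indicator (cbox a b) x" for k x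
    using bump_eq_0[of x a b] box_subset_cbox[of a b] by (auto simp: indicator_def)
  have bumpm [measurable]: "bump a b (?c k) \<in> borel_measurable lebesgue" for k
    using borel_measurable_lebesgue_on_continuous[OF test_functions_continuous[OF bump_test_function[OF c ab]], where S = UNIV]
    by simp
  have *: "(LINT x|lebesgue. indicator (cbox a b) x * g x * bump a b (?c k) x) = 0" for k
  proof -
    have "0 = (LINT x|lebesgue_on \<Omega>. g x * bump a b (?c k) x)"
      using zero bump_test_function[OF c ab] by simp
    also have "\<dots> = (LINT x|lebesgue. indicator \<Omega> x *\<^sub>R (g x * bump a b (?c k) x))"
      using \<Omega> by (intro integral_restrict_space) simp
    also have "(\<lambda>x. indicator \<Omega> x *\<^sub>R (g x * bump a b (?c k) x)) =
        (\<lambda>x. indicator (cbox a b) x * g x * bump a b (?c k) x)"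
    proof
      fix x show "indicator \<Omega> x *\<^sub>R (g x * bump a b (?c k) x) = indicator (cbox a b) x * g x * bump a b (?c k) x"
        using ab by (subst (1 2) supp) (auto simp: indicator_def)
    qed
    finally show ?thesis by simp
  qed
  have "(\<lambda>k. LINT x|lebesgue. indicator (cbox a b) x * g x * bump a b (?c k) x)
      \<longlonglongrightarrow> (LINT x|lebesgue. indicator (cbox a b) x * g x * indicator (box a b) x)"
  proof (rule integral_dominated_convergence)
    show "integrable lebesgue (\<lambda>x. norm (indicator (cbox a b) x * g x))" using int by (rule integrable_norm)
    show "AE x in lebesgue. (\<lambda>k. indicator (cbox a b) x * g x * bump a b (?c k) x)
        \<longlonglongrightarrow> indicator (cbox a b) x * g x * indicator (box a b) x"
      by (intro AE_I2 tendsto_mult tendsto_const bump_tendsto_indicator)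
    have "\<bar>bump a b (?c k) x\<bar> \<le> 1" for k x using bump_bounds[OF c[of k], of a b x] by simp
    then show "AE x in lebesgue. norm (indicator (cbox a b) x * g x * bump a b (?c k) x)
        \<le> norm (indicator (cbox a b) x * g x)" for k
      by (intro AE_I2) (metis abs_ge_zero abs_mult mult_left_le real_norm_def)
    have [measurable]: "box a b \<in> sets lebesgue" by simp
    show "(\<lambda>x. indicator (cbox a b) x * g x * indicator (box a b) x) \<in> borel_measurable lebesgue" by measurable
    show "(\<lambda>x. indicator (cbox a b) x * g x * bump a b (?c k) x) \<in> borel_measurable lebesgue" for k by measurable
  qed
  then have "(LINT x|lebesgue. indicator (cbox a b) x * g x * indicator (box a b) x) = 0"
    unfolding * by (simp add: LIMSEQ_const_iff)
  moreover have "(\<lambda>x. indicator (cbox a b) x * g x * indicator (box a b) x) = (\<lambda>x. indicator (box a b) x * g x)"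
    using box_subset_cbox[of a b] by (force simp: indicator_def)
  ultimately show "(LINT x|lebesgue. indicator (box a b) x * g x) = 0" by simp
qed

text \<open>Dynkin's argument: open boxes are closed under intersection and generate the Borel sets,
  and the sets over which \<open>G\<close> integrates to zero are closed under countable disjoint
  unions and complements. The total integral serves the complements.\<close>

lemma AE_eq_0_if_box_integrals_eq_0:
  fixes G :: "'a::euclidean_space \<Rightarrow> real"
  assumes G: "integrable lborel G" and total: "(LINT x|lborel. G x) = 0"
    and box: "\<And>c d. (LINT x:box c d|lborel. G x) = 0"
  shows "AE x in lborel. G x = 0"
proof (rule sigma_finite_measure.density_zero[OF lborel.sigma_finite_measure_axioms G])
  fix A :: "'a set" assume "A \<in> sets lborel"
  then have "A \<in> sigma_sets UNIV (range (\<lambda>(a, b). box a b))"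
    by (simp add: borel_eq_box)
  moreover have "Int_stable (range (\<lambda>(a, b). box a b :: 'a set))"
    by (force simp: Int_stable_def box_Int_box)
  moreover have sets: "X \<in> sets lborel" if "X \<in> sigma_sets UNIV (range (\<lambda>(a, b). box a b))" for X :: "'a set"
    using that by (simp add: borel_eq_box)
  have int: "set_integrable lborel X G" if "X \<in> sets lborel" for X
    using integrable_mult_indicator[OF that G] by (simp add: set_integrable_def)
  show "(LINT x:A|lborel. G x) = 0"
  proof (rule sigma_sets_induct_disjoint[OF calculation(2) _ calculation(1)])
    fix X :: "'a set" assume X: "X \<in> sigma_sets UNIV (range (\<lambda>(a, b). box a b))" and 0: "(LINT x:X|lborel. G x) = 0"
    have "(LINT x:X \<union> (UNIV - X)|lborel. G x) = (LINT x:X|lborel. G x) + (LINT x:UNIV - X|lborel. G x)"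
      using sets[OF X] by (intro set_integral_Un int) auto
    then show "(LINT x:UNIV - X|lborel. G x) = 0"
      using 0 total by (simp add: set_lebesgue_integral_def)
  next
    fix X :: "nat \<Rightarrow> 'a set"
    assume X: "disjoint_family X" "range X \<subseteq> sigma_sets UNIV (range (\<lambda>(a, b). box a b))"
      "\<And>i. (LINT x:X i|lborel. G x) = 0"
    have m: "X i \<in> sets lborel" for i using X(2) sets by blast
    have "(LINT x:(\<Union>i. X i)|lborel. G x) = (\<Sum>i. LINT x:X i|lborel. G x)"
      using X(1) m by (intro lebesgue_integral_countable_add int) (auto simp: disjoint_family_on_def)
    then show "(LINT x:(\<Union>i. X i)|lborel. G x) = 0" using X(3) by simp
  qed (use box in \<open>auto simp: set_lebesgue_integral_def\<close>)
qed

text \<open>Local integrability restricts the measure-theoretic argument to one box at a time.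
  Inside a box, integrals over all smaller boxes vanish by testing with bumps; countably many boxes
  cover \<open>\<Omega>\<close>, so the exceptional null sets add up to a null set.\<close>

lemma fundamental_lemma_calculus_of_variations:
  fixes g :: "real^'n::finite \<Rightarrow> real"
  assumes \<Omega>: "open \<Omega>" and g: "g \<in> Lp_loc \<Omega> 1"
    and zero: "\<And>\<phi>. \<phi> \<in> test_functions \<Omega> \<Longrightarrow> (LINT x|lebesgue_on \<Omega>. g x * \<phi> x) = 0"
  shows "AE x in lebesgue_on \<Omega>. g x = 0"
proof -
  have \<Omega>s: "\<Omega> \<in> sets lebesgue" using \<Omega> by (simp add: borel_open)
  have local: "AE x in lebesgue. x \<in> box a b \<longrightarrow> g x = 0" if ab: "cbox a b \<subseteq> \<Omega>" for a b
  proof -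
    let ?G = "\<lambda>x. indicator (box a b) x * g x"
    have "integrable lebesgue (\<lambda>x. indicator (box a b) x *\<^sub>R (indicator (cbox a b) x * g x))"
      using integral_box_eq_0(1)[OF \<Omega>s g zero ab] by (intro integrable_mult_indicator) auto
    also have "(\<lambda>x. indicator (box a b) x *\<^sub>R (indicator (cbox a b) x * g x)) = ?G"
      using box_subset_cbox[of a b] by (force simp: indicator_def)
    finally have G: "integrable lebesgue ?G" .
    then have "?G \<in> borel_measurable lebesgue" by simp
    \<comment> \<open>Dynkin's argument runs over Borel sets, so the Lebesgue measurable function is
      replaced by a Borel one that agrees with it almost everywhere.\<close>
    then obtain G' where G'm: "G' \<in> borel_measurable lborel" and AE: "AE x in lborel. ?G x = G' x"
      using completion_ex_borel_measurable_real by blast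
    have AE': "AE x in lebesgue. ?G x = G' x" using AE by (rule AE_completion)
    have G'l: "integrable lebesgue G'"
      using integrable_cong_AE_imp[OF G measurable_completion[OF G'm] AE'] .
    then have G'i: "integrable lborel G'" using G'm by (simp add: integrable_completion)
    have *: "(LINT x|lborel. indicator X x * G' x) = (LINT x|lebesgue. indicator X x * ?G x)"
      if X: "X \<in> sets borel" for X
    proof -
      have X' [measurable]: "X \<in> sets lborel" "X \<in> sets lebesgue" using X by auto
      have [measurable]: "G' \<in> borel_measurable lebesgue" "?G \<in> borel_measurable lebesgue" using G G'l by auto
      have "(LINT x|lborel. indicator X x * G' x) = (LINT x|lebesgue. indicator X x * G' x)"
        using G'm X'(1)
        by (intro integral_completion[symmetric] borel_measurable_times borel_measurable_indicator)
      also have "\<dots> = (LINT x|lebesgue. indicator X x * ?G x)"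
        using AE' by (intro integral_cong_AE) (auto elim!: eventually_mono)
      finally show ?thesis .
    qed
    have "AE x in lborel. G' x = 0"
    proof (rule AE_eq_0_if_box_integrals_eq_0[OF G'i])
      show "(LINT x|lborel. G' x) = 0"
        using *[of UNIV] integral_box_eq_0(2)[OF \<Omega>s g zero ab] by simp
      show "(LINT x:box c d|lborel. G' x) = 0" for c d
      proof -
        obtain a' b' where ab': "box c d \<inter> box a b = box a' b'"
          by (rule that[OF box_Int_box])
        have 1: "(\<lambda>x. indicator (box c d) x * ?G x) = (\<lambda>x. indicator (box a' b') x * g x)"
          unfolding ab'[symmetric] by (auto simp: indicator_def)
        \<comment> \<open>If the intersection is nonempty, its closed box is its closure and stays
          inside \<open>cbox a b\<close>. If it is empty, nothing is known about the closed box, but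
          the integral is trivially zero.\<close>
        have "cbox a' b' \<subseteq> \<Omega> \<or> box a' b' = {}"
        proof (cases "box a' b' = {}")
          case False
          then have "cbox a' b' = closure (box a' b')" by (simp add: closure_box)
          also have "\<dots> \<subseteq> cbox a b"
            using ab' box_subset_cbox[of a b] by (intro closure_minimal) auto
          finally show ?thesis using ab by blast
        qed simp
        then have "(LINT x|lebesgue. indicator (box a' b') x * g x) = 0"
          using integral_box_eq_0(2)[OF \<Omega>s g zero] by auto
        then show ?thesis using *[of "box c d"] 1 by (simp add: set_lebesgue_integral_def)
      qed
    qed
    with AE have "AE x in lborel. x \<in> box a b \<longrightarrow> g x = 0"
      by eventually_elim (auto simp: indicator_def)
    then show ?thesis by (rule AE_completion)
  qed
  let ?F = "{box a b |a b. cbox a b \<subseteq> \<Omega>}"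
  obtain F' where F': "F' \<subseteq> ?F" "countable F'" "\<Union>F' = \<Union>?F"
    by (rule Lindelof[of ?F]) auto
  have "\<Omega> \<subseteq> \<Union>?F"
  proof
    fix x assume "x \<in> \<Omega>"
    obtain a b where "x \<in> box a b" "cbox a b \<subseteq> \<Omega>"
      by (rule open_contains_cbox[OF \<Omega> \<open>x \<in> \<Omega>\<close>])
    then show "x \<in> \<Union>?F" by blast
  qed
  moreover have "AE x in lebesgue. \<forall>X\<in>F'. x \<in> X \<longrightarrow> g x = 0"
    using F' local by (subst AE_ball_countable) auto
  ultimately have "AE x in lebesgue. x \<in> \<Omega> \<longrightarrow> g x = 0"
    using F'(3) by (auto elim!: eventually_mono)
  then show ?thesis using \<Omega>s by (simp add: AE_restrict_space_iff)
qed


section \<open>Integration by parts\<close>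

text \<open>The mean value theorem on a coordinate line. Writing the quotient as a value of the
  partial derivative gives its limit, by continuity, and a bound uniform in the step.\<close>

lemma test_function_difference_quotient:
  fixes \<phi> :: "real^'n::finite \<Rightarrow> real"
  assumes \<phi>: "\<phi> \<in> test_functions \<Omega>" and h: "h > 0"
  shows "\<exists>z. 0 < z \<and> z < h \<and> \<phi> (x + h *\<^sub>R axis i 1) - \<phi> x = h * partial i \<phi> (x + z *\<^sub>R axis i 1)"
proof -
  have "((\<lambda>t. \<phi> (x + t *\<^sub>R axis i 1)) has_real_derivative partial i \<phi> (x + t *\<^sub>R axis i 1)) (at t)" for t
  proof -
    let ?D = "frechet_derivative \<phi> (at (x + t *\<^sub>R axis i 1))"
    have D: "(\<phi> has_derivative ?D) (at (x + t *\<^sub>R axis i 1))"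
      using test_functions_differentiable[OF \<phi>] frechet_derivative_works by blast
    have "((\<lambda>t. x + t *\<^sub>R axis i 1) has_derivative (\<lambda>h. h *\<^sub>R axis i 1)) (at t)"
      by (auto intro!: derivative_eq_intros)
    from has_derivative_compose[OF this D]
    have "((\<lambda>t. \<phi> (x + t *\<^sub>R axis i 1)) has_derivative (\<lambda>h. ?D (h *\<^sub>R axis i 1))) (at t)" .
    moreover have "(\<lambda>h. ?D (h *\<^sub>R axis i 1)) = (*) (partial i \<phi> (x + t *\<^sub>R axis i 1))"
      using linear_scale[OF has_derivative_linear[OF D]] by (auto simp: partial_def mult.commute)
    ultimately show ?thesis by (simp add: has_field_derivative_def)
  qed
  from MVT2[OF h this] show ?thesis by simp
qed

lemma integrable_test_function:
  assumes "\<phi> \<in> test_functions \<Omega>"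
  shows "integrable lborel \<phi>"
proof -
  obtain K where K: "compact K" "\<And>x. x \<notin> K \<Longrightarrow> \<phi> x = 0"
    by (rule test_functionsE[OF assms]) blast
  have "integrable lborel (\<lambda>x. indicator K x *\<^sub>R \<phi> x)"
    using K(1) continuous_on_subset[OF test_functions_continuous[OF assms]]
    by (rule borel_integrable_compact) simp
  moreover have "(\<lambda>x. indicator K x *\<^sub>R \<phi> x) = \<phi>"
    using K(2) by (force simp: indicator_def)
  ultimately show ?thesis by simp
qed

text \<open>The difference quotients have integral zero by translation invariance.\<close>

lemma integral_partial_test_function:
  fixes \<phi> :: "real^'n::finite \<Rightarrow> real"
  assumes \<phi>: "\<phi> \<in> test_functions \<Omega>"
  shows "(LINT x|lborel. partial i \<phi> x) = 0"
proof -
  let ?e = "axis i 1 :: real^'n"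
  let ?h = "\<lambda>k. inverse (real (Suc k))"
  let ?D = "\<lambda>k x. (\<phi> (x + ?h k *\<^sub>R ?e) - \<phi> x) / ?h k"
  note d\<phi> = test_functions_partial[OF \<phi>, of i]
  obtain K where K: "compact K" "\<And>x. x \<notin> K \<Longrightarrow> partial i \<phi> x = 0"
    by (rule test_functionsE[OF \<phi>]) blast
  obtain R where R: "\<And>x. x \<in> K \<Longrightarrow> norm x \<le> R"
    using compact_imp_bounded[OF K(1)] by (auto simp: bounded_iff)
  obtain B where B: "\<And>x. \<bar>partial i \<phi> x\<bar> \<le> B" by (rule test_functions_bounded[OF d\<phi>]) blast
  have q: "\<exists>z. 0 < z \<and> z < ?h k \<and> ?D k x = partial i \<phi> (x + z *\<^sub>R ?e)" for k x
    using test_function_difference_quotient[OF \<phi>, of "?h k" x i] by (auto simp: field_simps)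
  have int: "integrable lborel (?D k)" and zero: "(LINT x|lborel. ?D k x) = 0" for k
  proof -
    let ?T = "\<lambda>x. \<phi> (x + ?h k *\<^sub>R ?e)"
    have i0: "integrable lborel \<phi>" by (rule integrable_test_function[OF \<phi>])
    have d: "distr lborel borel (\<lambda>x. ?h k *\<^sub>R ?e + x) = lborel" by (rule lborel_distr_plus)
    have "integrable (distr lborel borel (\<lambda>x. ?h k *\<^sub>R ?e + x)) \<phi>" using i0 unfolding d .
    then have i1: "integrable lborel ?T"
      by (subst (asm) integrable_distr_eq) (use i0 in \<open>auto simp: add.commute\<close>)
    have "(LINT x|lborel. \<phi> x) = (LINT x|distr lborel borel (\<lambda>x. ?h k *\<^sub>R ?e + x). \<phi> x)"
      unfolding d ..
    also have "\<dots> = (LINT x|lborel. ?T x)"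
      by (subst integral_distr) (use i0 in \<open>auto simp: add.commute\<close>)
    finally have eq: "(LINT x|lborel. ?T x) = (LINT x|lborel. \<phi> x)" ..
    show "integrable lborel (?D k)" using i0 i1 by simp
    show "(LINT x|lborel. ?D k x) = 0" using i0 i1 eq by simp
  qed
  have "(\<lambda>k. LINT x|lborel. ?D k x) \<longlonglongrightarrow> (LINT x|lborel. partial i \<phi> x)"
  proof (rule integral_dominated_convergence)
    \<comment> \<open>The quotient at x is a value of the derivative at distance less than 1 from x,
      because the steps are at most 1; so it vanishes once x is outside the ball of radius R +
      1.\<close>
    show "integrable lborel (\<lambda>x::real^'n. indicator (cball 0 (R + 1)) x * B)"
      using borel_integrable_compact[OF compact_cball continuous_on_const, of 0 "R + 1" B] by simp
    show "partial i \<phi> \<in> borel_measurable lborel"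
      using integrable_test_function[OF d\<phi>] by simp
    show "?D k \<in> borel_measurable lborel" for k using int by simp
    show "AE x in lborel. (\<lambda>k. ?D k x) \<longlonglongrightarrow> partial i \<phi> x"
    proof (rule AE_I2)
      fix x
      have "\<forall>k. \<exists>z. 0 < z \<and> z < ?h k \<and> ?D k x = partial i \<phi> (x + z *\<^sub>R ?e)" using q by blast
      then obtain z where z: "\<And>k. 0 < z k \<and> z k < ?h k \<and> ?D k x = partial i \<phi> (x + z k *\<^sub>R ?e)" by metis
      have "z \<longlonglongrightarrow> 0"
        by (rule tendsto_sandwich[OF _ _ tendsto_const LIMSEQ_inverse_real_of_nat])
          (use z in \<open>auto intro!: always_eventually less_imp_le\<close>)
      then have "(\<lambda>k. x + z k *\<^sub>R ?e) \<longlonglongrightarrow> x + 0 *\<^sub>R ?e" by (intro tendsto_intros)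
      then have "(\<lambda>k. x + z k *\<^sub>R ?e) \<longlonglongrightarrow> x" by simp
      moreover have "isCont (partial i \<phi>) x"
        using test_functions_continuous[OF d\<phi>] by (simp add: continuous_on_eq_continuous_at)
      ultimately have "(\<lambda>k. partial i \<phi> (x + z k *\<^sub>R ?e)) \<longlonglongrightarrow> partial i \<phi> x"
        by (rule isCont_tendsto_compose[rotated])
      then show "(\<lambda>k. ?D k x) \<longlonglongrightarrow> partial i \<phi> x" using z by simp
    qed
    show "AE x in lborel. norm (?D k x) \<le> indicator (cball 0 (R + 1)) x * B" for k
    proof (rule AE_I2)
      fix x
      obtain z where z: "0 < z" "z < ?h k" "?D k x = partial i \<phi> (x + z *\<^sub>R ?e)" using q by blast
      show "norm (?D k x) \<le> indicator (cball 0 (R + 1)) x * B"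
      proof (cases "x \<in> cball 0 (R + 1)")
        case True
        then show ?thesis using z(3) B by simp
      next
        case False
        have "?h k \<le> 1" by (simp add: inverse_le_1_iff)
        then have "norm (z *\<^sub>R ?e) \<le> 1" using z by simp
        then have "norm (x + z *\<^sub>R ?e) > R"
          using False norm_triangle_ineq4[of "x + z *\<^sub>R ?e" "z *\<^sub>R ?e"] by simp
        then have "x + z *\<^sub>R ?e \<notin> K" using R by force
        then show ?thesis using z(3) K(2) False by simp
      qed
    qed
  qed
  then show ?thesis unfolding zero by (simp add: LIMSEQ_const_iff)
qed

lemma integral_lebesgue_on_support:
  fixes f :: "'a::euclidean_space \<Rightarrow> real"
  assumes "S \<in> sets lebesgue" "\<And>x. x \<notin> S \<Longrightarrow> f x = 0" "f \<in> borel_measurable lborel"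
  shows "(LINT x|lebesgue_on S. f x) = (LINT x|lborel. f x)"
proof -
  have "(LINT x|lebesgue_on S. f x) = (LINT x|lebesgue. indicator S x *\<^sub>R f x)"
    using assms(1) by (intro integral_restrict_space) simp
  also have "(\<lambda>x. indicator S x *\<^sub>R f x) = f" using assms(2) by (force simp: indicator_def)
  finally show ?thesis using assms(3) by (simp add: integral_completion)
qed

text \<open>The product of two test functions is a test function, so its partial derivative
  integrates to zero; the product rule splits that integral. Compact support in
  \<open>\<Omega>\<close> makes integration over \<open>\<Omega>\<close> and over the whole space
  agree.\<close>

lemma integration_by_parts_test_functions:
  assumes \<Omega>: "\<Omega> \<in> sets lebesgue" and \<phi>: "\<phi> \<in> test_functions \<Omega>" and \<eta>: "\<eta> \<in> test_functions \<Omega>"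
  shows "(LINT x|lebesgue_on \<Omega>. \<phi> x * partial i \<eta> x) = - (LINT x|lebesgue_on \<Omega>. partial i \<phi> x * \<eta> x)"
proof -
  have F: "(\<lambda>x. \<phi> x * \<eta> x) \<in> test_functions \<Omega>"
    using test_functions_mult[OF \<phi> test_functions_C_k[OF \<eta>]] .
  have i1: "(\<lambda>x. \<phi> x * partial i \<eta> x) \<in> test_functions \<Omega>"
    using test_functions_mult[OF \<phi> test_functions_C_k[OF test_functions_partial[OF \<eta>]]] .
  have i2: "(\<lambda>x. partial i \<phi> x * \<eta> x) \<in> test_functions \<Omega>"
    using test_functions_mult[OF test_functions_partial[OF \<phi>] test_functions_C_k[OF \<eta>]] .
  have eq: "(LINT x|lebesgue_on \<Omega>. g x) = (LINT x|lborel. g x)" if g: "g \<in> test_functions \<Omega>" for g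
  proof -
    obtain K where "K \<subseteq> \<Omega>" "\<And>x. x \<notin> K \<Longrightarrow> g x = 0" by (rule test_functionsE[OF g]) blast
    then show ?thesis
      using integrable_test_function[OF g] by (intro integral_lebesgue_on_support[OF \<Omega>]) auto
  qed
  have "0 = (LINT x|lborel. partial i (\<lambda>x. \<phi> x * \<eta> x) x)"
    using integral_partial_test_function[OF F] by simp
  also have "partial i (\<lambda>x. \<phi> x * \<eta> x) = (\<lambda>x. \<phi> x * partial i \<eta> x + partial i \<phi> x * \<eta> x)"
    using \<phi> \<eta> by (intro partial_mult) (auto dest: test_functions_differentiable)
  also have "(LINT x|lborel. \<phi> x * partial i \<eta> x + partial i \<phi> x * \<eta> x) =
      (LINT x|lborel. \<phi> x * partial i \<eta> x) + (LINT x|lborel. partial i \<phi> x * \<eta> x)"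
    using integrable_test_function[OF i1] integrable_test_function[OF i2]
    by (rule Bochner_Integration.integral_add)
  finally show ?thesis unfolding eq[OF i1] eq[OF i2] by simp
qed

lemma continuous_compact_support_Lp:
  fixes g :: "real^'n::finite \<Rightarrow> 'b::euclidean_space"
  assumes S: "S \<in> sets lebesgue" and g: "continuous_on UNIV g" and K: "compact K" "\<And>x. x \<notin> K \<Longrightarrow> g x = 0"
    and p: "p > 0"
  shows "g \<in> Lp S p"
proof -
  have m [measurable]: "g \<in> borel_measurable (lebesgue_on S)"
    using g by (rule borel_measurable_lebesgue_on_continuous)
  have "compact (g ` K)" using K g by (blast intro: compact_continuous_image continuous_on_subset)
  then obtain B where B: "B > 0" "\<And>x. x \<in> K \<Longrightarrow> norm (g x) \<le> B"
    using compact_imp_bounded bounded_pos by (metis imageI)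
  have "K \<in> lmeasurable" using K by (simp add: lmeasurable_compact)
  then have "integrable lebesgue (indicator K :: _ \<Rightarrow> real)" 
    by (intro integrable_real_indicator) (auto simp: fmeasurable_def)
  then have "integrable lebesgue (\<lambda>x. indicator S x *\<^sub>R (indicator K x * B powr p))"
    using S by (intro integrable_mult_indicator integrable_mult_left) auto
  then have "integrable (lebesgue_on S) (\<lambda>x. indicator K x * B powr p)"
    using S by (subst integrable_restrict_space) auto
  then have "integrable (lebesgue_on S) (\<lambda>x. norm (g x) powr p)"
  proof (rule Bochner_Integration.integrable_bound)
    show "AE x in lebesgue_on S. norm (norm (g x) powr p) \<le> norm (indicator K x * B powr p)"
      using B K(2) p by (intro AE_I2) (auto simp: indicator_def powr_mono2)
  qed measurable
  then show ?thesis using m by (simp add: Lp_def)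
qed

lemma test_function_Lp:
  assumes "\<phi> \<in> test_functions \<Omega>" "S \<in> sets lebesgue" "p > 0"
  shows "\<phi> \<in> Lp S p" "(\<lambda>x. \<chi> i. partial i \<phi> x) \<in> Lp S p"
proof -
  obtain K where K: "compact K" "\<And>x. x \<notin> K \<Longrightarrow> \<phi> x = 0" "\<And>i x. x \<notin> K \<Longrightarrow> partial i \<phi> x = 0"
    by (rule test_functionsE[OF assms(1)]) blast
  show "\<phi> \<in> Lp S p"
    using K test_functions_continuous[OF assms(1)] assms by (intro continuous_compact_support_Lp)
  have "continuous_on UNIV (\<lambda>x. \<chi> i. partial i \<phi> x)"
    using test_functions_continuous[OF test_functions_partial[OF assms(1)]]
    by (intro continuous_on_vec_lambda)
  then show "(\<lambda>x. \<chi> i. partial i \<phi> x) \<in> Lp S p"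
    using K assms by (intro continuous_compact_support_Lp) (auto simp: vec_eq_iff)
qed

lemma test_function_has_weak_gradient:
  assumes "\<Omega> \<in> sets lebesgue" "\<phi> \<in> test_functions \<Omega>"
  shows "has_weak_gradient \<Omega> \<phi> (\<lambda>x. \<chi> i. partial i \<phi> x)"
  unfolding has_weak_gradient_def Lp_loc_def
  using assms integration_by_parts_test_functions[OF assms]
  by (auto intro!: test_function_Lp simp: fmeasurableD lmeasurable_compact)

text \<open>This makes w - \<phi> a Sobolev function whenever w is one, so that the distances
  defining \<open>sobolev0\<close> obey the triangle inequality.\<close>

lemma test_function_sobolev:
  assumes "\<Omega> \<in> sets lebesgue" "\<phi> \<in> test_functions \<Omega>" "p > 0"
  shows "\<phi> \<in> sobolev \<Omega> p"
  unfolding sobolev_def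
  using test_function_has_weak_gradient[OF assms(1,2)] test_function_Lp[OF assms(2,1,3)] by blast


section \<open>Sobolev functions\<close>

text \<open>The pointwise vector space structure lets \<open>subspace\<close>, \<open>convex\<close>
  and the abstract separation theorem apply to sets of functions.\<close>

instantiation "fun" :: (type, real_vector) real_vector
begin

definition scaleR_fun :: "real \<Rightarrow> ('a \<Rightarrow> 'b) \<Rightarrow> 'a \<Rightarrow> 'b" where
  "scaleR_fun c f = (\<lambda>x. c *\<^sub>R f x)"

instance
  by standard (auto simp: scaleR_fun_def plus_fun_def algebra_simps)

end

text \<open>Minkowski's inequality: by homogeneity, the unit ball of the \<open>p\<close>-th root of a convex function is convex.\<close>

lemma seminorm_on_convex_homogeneous_powr:
  fixes V :: "'a::real_vector set"
  assumes V: "subspace V" and p: "p > 0" and nonneg: "\<And>x. x \<in> V \<Longrightarrow> 0 \<le> \<Phi> x"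
    and hom: "\<And>c x. x \<in> V \<Longrightarrow> \<Phi> (c *\<^sub>R x) = \<bar>c\<bar> powr p * \<Phi> x"
    and conv: "\<And>s t x y. x \<in> V \<Longrightarrow> y \<in> V \<Longrightarrow> 0 \<le> s \<Longrightarrow> 0 \<le> t \<Longrightarrow> s + t = 1 \<Longrightarrow>
      \<Phi> (s *\<^sub>R x + t *\<^sub>R y) \<le> s * \<Phi> x + t * \<Phi> y"
  shows "seminorm_on V (\<lambda>x. \<Phi> x powr (1 / p))"
  unfolding seminorm_on_def
proof (intro conjI ballI allI)
  let ?N = "\<lambda>x. \<Phi> x powr (1 / p)"
  show scale: "?N (c *\<^sub>R x) = \<bar>c\<bar> * ?N x" if "x \<in> V" for c x
    using that p nonneg by (simp add: hom powr_mult powr_powr)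
  fix x y assume xy: "x \<in> V" "y \<in> V"
  have le: "\<Phi> z \<le> 1" if "z \<in> V" "?N z \<le> 1" for z
  proof -
    have "(\<Phi> z powr (1 / p)) powr p \<le> 1 powr p" using that p by (intro powr_mono2) auto
    then show ?thesis using nonneg[OF that(1)] p by (simp add: powr_powr)
  qed
  show "?N (x + y) \<le> ?N x + ?N y"
  proof (rule field_le_epsilon)
    fix e :: real assume e: "e > 0"
    \<comment> \<open>The summand e / 2 keeps the scaling factor positive even when the seminorm of
      x is zero. Dividing x and y by \<open>a\<close> and \<open>b\<close> puts both into the unit
      ball, and \<open>?z\<close> is the convex combination whose multiple by a + b is x +
      y.\<close>
    define a where "a = ?N x + e / 2"
    define b where "b = ?N y + e / 2"
    have ab: "a > 0" "b > 0" using e by (auto simp: a_def b_def add_nonneg_pos)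
    let ?z = "(a / (a + b)) *\<^sub>R (inverse a *\<^sub>R x) + (b / (a + b)) *\<^sub>R (inverse b *\<^sub>R y)"
    have V1: "inverse a *\<^sub>R x \<in> V" "inverse b *\<^sub>R y \<in> V" using xy V by (auto intro: subspace_scale)
    have "?N (inverse a *\<^sub>R x) \<le> 1" "?N (inverse b *\<^sub>R y) \<le> 1"
      using ab e unfolding scale[OF xy(1)] scale[OF xy(2)] by (auto simp: field_simps a_def b_def)
    then have 1: "\<Phi> (inverse a *\<^sub>R x) \<le> 1" "\<Phi> (inverse b *\<^sub>R y) \<le> 1" using le V1 by auto
    have st: "a / (a + b) + b / (a + b) = 1" "0 \<le> a / (a + b)" "0 \<le> b / (a + b)"
      using ab by (auto simp: add_divide_distrib[symmetric])
    have "\<Phi> ?z \<le> a / (a + b) * \<Phi> (inverse a *\<^sub>R x) + b / (a + b) * \<Phi> (inverse b *\<^sub>R y)"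
      using V1 st by (intro conv)
    also have "\<dots> \<le> a / (a + b) * 1 + b / (a + b) * 1" using 1 st by (intro add_mono mult_left_mono)
    also have "\<dots> = 1" using st by simp
    finally have "\<Phi> ?z \<le> 1" .
    moreover have zV: "?z \<in> V" 
      by (rule subspace_add[OF V subspace_scale[OF V V1(1)] subspace_scale[OF V V1(2)]])
    ultimately have Nz: "?N ?z \<le> 1" using nonneg p by (intro powr_le1) auto
    have "(a + b) *\<^sub>R ?z = x + y" using ab by (simp add: scaleR_add_right)
    then have "?N (x + y) = (a + b) * ?N ?z" using scale[OF zV, of "a + b"] ab by simp
    also have "\<dots> \<le> (a + b) * 1" using Nz ab by (intro mult_left_mono) auto
    finally show "?N (x + y) \<le> ?N x + ?N y + e" by (simp add: a_def b_def)
  qed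
qed

lemma norm_powr_convex:
  fixes x y :: "'a::real_normed_vector"
  assumes p: "p \<ge> 1" and st: "0 \<le> s" "0 \<le> t" "s + t = 1"
  shows "norm (s *\<^sub>R x + t *\<^sub>R y) powr p \<le> s * norm x powr p + t * norm y powr p"
proof -
  have real: "(s * a + t * b) powr p \<le> s * a powr p + t * b powr p" if ab: "0 \<le> a" "0 \<le> b" for a b :: real
  proof -
    \<comment> \<open>For weights in [0, 1] and exponent at least 1; this settles the cases where
      one argument is zero, leaving convexity of the power on positive numbers.\<close>
    have le: "s powr p \<le> s" "t powr p \<le> t"
      using powr_mono'[of 1 p s] powr_mono'[of 1 p t] p st by auto
    consider "a = 0" | "b = 0" | "a > 0" "b > 0" using ab by linarith
    then show ?thesis
    proof cases
      case 1
      then show ?thesis using ab st le p by (simp add: powr_mult mult_right_mono)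
    next
      case 2
      then show ?thesis using ab st le p by (simp add: powr_mult mult_right_mono)
    next
      case 3
      have s: "s = 1 - t" using st by simp
      show ?thesis using convex_onD[OF powr_convex[OF p], of t a b] 3 st unfolding s by simp
    qed
  qed
  have "norm (s *\<^sub>R x + t *\<^sub>R y) \<le> s * norm x + t * norm y"
    by (rule order_trans[OF norm_triangle_ineq]) (use st in simp)
  then have "norm (s *\<^sub>R x + t *\<^sub>R y) powr p \<le> (s * norm x + t * norm y) powr p"
    using p by (intro powr_mono2) auto
  then show ?thesis using real[of "norm x" "norm y"] by simp
qed

section \<open>Vector space operations and almost everywhere equality in L^p\<close>

lemma Lp_scale:
  assumes "g \<in> Lp \<Omega> p"
  shows "(\<lambda>x. c *\<^sub>R g x) \<in> Lp \<Omega> p"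
  using assms by (auto simp: Lp_def powr_mult)

text \<open>Convexity of the p-th power dominates the midpoint by an integrable function; doubling
  the midpoint gives the sum.\<close>

lemma Lp_add:
  assumes p: "p \<ge> 1" and g: "g \<in> Lp \<Omega> p" and h: "h \<in> Lp \<Omega> p"
  shows "(\<lambda>x. g x + h x) \<in> Lp \<Omega> p"
proof -
  have "(\<lambda>x. (1/2) *\<^sub>R g x + (1/2) *\<^sub>R h x) \<in> Lp \<Omega> p"
  proof -
    have [measurable]: "g \<in> borel_measurable (lebesgue_on \<Omega>)" "h \<in> borel_measurable (lebesgue_on \<Omega>)"
      using g h by (auto simp: Lp_def)
    have "integrable (lebesgue_on \<Omega>) (\<lambda>x. norm ((1/2) *\<^sub>R g x + (1/2) *\<^sub>R h x) powr p)"
    proof (rule Bochner_Integration.integrable_bound)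
      show "integrable (lebesgue_on \<Omega>) (\<lambda>x. 1/2 * norm (g x) powr p + 1/2 * norm (h x) powr p)"
        using g h by (intro Bochner_Integration.integrable_add integrable_mult_right) (auto simp: Lp_def)
      show "AE x in lebesgue_on \<Omega>. norm (norm ((1/2) *\<^sub>R g x + (1/2) *\<^sub>R h x) powr p)
          \<le> norm (1/2 * norm (g x) powr p + 1/2 * norm (h x) powr p)"
      proof (rule AE_I2)
        fix x
        show "norm (norm ((1/2) *\<^sub>R g x + (1/2) *\<^sub>R h x) powr p)
          \<le> norm (1/2 * norm (g x) powr p + 1/2 * norm (h x) powr p)"
          using norm_powr_convex[OF p, of "1/2" "1/2" "g x" "h x"] by simp
      qed
    qed measurable
    then show ?thesis by (auto simp: Lp_def)
  qed
  from Lp_scale[OF this, of 2] show ?thesis by (simp add: scaleR_add_right)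
qed

text \<open>Completeness of Lebesgue measure. Multiplication by the indicator of \<open>S\<close>
  moves the question to the whole space, where the measure is a completion.\<close>

lemma borel_measurable_lebesgue_on_AE:
  fixes f :: "'a::euclidean_space \<Rightarrow> 'b::euclidean_space"
  assumes S: "S \<in> sets lebesgue" and f: "f \<in> borel_measurable (lebesgue_on S)"
    and ae: "AE x in lebesgue_on S. f x = g x"
  shows "g \<in> borel_measurable (lebesgue_on S)"
proof -
  have "(\<lambda>x. indicator S x *\<^sub>R f x) \<in> borel_measurable lebesgue"
    using S f by (simp add: borel_measurable_restrict_space_iff)
  moreover have "AE x in lebesgue. indicator S x *\<^sub>R f x = indicator S x *\<^sub>R g x"
    using ae S by (auto simp: AE_restrict_space_iff indicator_def elim!: eventually_mono)
  ultimately have "(\<lambda>x. indicator S x *\<^sub>R g x) \<in> borel_measurable lebesgue"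
    by (rule borel_measurable_AE)
  then show ?thesis using S by (simp add: borel_measurable_restrict_space_iff)
qed

lemma Lp_AE:
  assumes S: "S \<in> sets lebesgue" and f: "f \<in> Lp S p" and ae: "AE x in lebesgue_on S. f x = g x"
  shows "g \<in> Lp S p"
proof -
  have fm [measurable]: "f \<in> borel_measurable (lebesgue_on S)" using f by (simp add: Lp_def)
  have gm [measurable]: "g \<in> borel_measurable (lebesgue_on S)"
    by (rule borel_measurable_lebesgue_on_AE[OF S fm ae])
  have "integrable (lebesgue_on S) (\<lambda>x. norm (g x) powr p)"
  proof (rule integrable_cong_AE_imp)
    show "integrable (lebesgue_on S) (\<lambda>x. norm (f x) powr p)" using f by (simp add: Lp_def)
    show "AE x in lebesgue_on S. norm (f x) powr p = norm (g x) powr p" using ae by eventually_elim simp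
  qed measurable
  then show ?thesis using gm by (simp add: Lp_def)
qed

lemma Lp_loc_nth:
  fixes g :: "real^'n::finite \<Rightarrow> real^'m::finite"
  shows "g \<in> Lp_loc \<Omega> 1 \<Longrightarrow> (\<lambda>x. g x $ i) \<in> Lp_loc \<Omega> 1"
  by (auto simp: Lp_loc_1_iff intro!: integrable_bounded_linear[OF bounded_linear_vec_nth])

lemma Lp_loc_lincomb:
  fixes g h :: "real^'n::finite \<Rightarrow> 'b::euclidean_space"
  shows "g \<in> Lp_loc \<Omega> 1 \<Longrightarrow> h \<in> Lp_loc \<Omega> 1 \<Longrightarrow> (\<lambda>x. a *\<^sub>R g x + b *\<^sub>R h x) \<in> Lp_loc \<Omega> 1"
  by (auto simp: Lp_loc_1_iff)

section \<open>Linearity and uniqueness of weak gradients\<close>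

lemma has_weak_gradient_lincomb:
  assumes \<Omega>: "\<Omega> \<in> sets lebesgue" and v: "has_weak_gradient \<Omega> v g" and w: "has_weak_gradient \<Omega> w h"
  shows "has_weak_gradient \<Omega> (\<lambda>x. a * v x + b * w x) (\<lambda>x. a *\<^sub>R g x + b *\<^sub>R h x)"
  unfolding has_weak_gradient_def
proof (intro conjI ballI allI)
  have loc: "v \<in> Lp_loc \<Omega> 1" "w \<in> Lp_loc \<Omega> 1" "g \<in> Lp_loc \<Omega> 1" "h \<in> Lp_loc \<Omega> 1"
    using v w by (auto simp: has_weak_gradient_def)
  show "(\<lambda>x. a * v x + b * w x) \<in> Lp_loc \<Omega> 1" using Lp_loc_lincomb[OF loc(1,2), of a b] by simp
  show "(\<lambda>x. a *\<^sub>R g x + b *\<^sub>R h x) \<in> Lp_loc \<Omega> 1" using Lp_loc_lincomb[OF loc(3,4)] .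
  fix \<phi> i assume \<phi>: "\<phi> \<in> test_functions \<Omega>"
  note d\<phi> = test_functions_partial[OF \<phi>, of i]
  \<comment> \<open>The integral splits only because each product with a test function is
    integrable, which local integrability guarantees.\<close>
  have lin: "(LINT x|lebesgue_on \<Omega>. (a * k x + b * l x) * \<eta> x) =
      a * (LINT x|lebesgue_on \<Omega>. k x * \<eta> x) + b * (LINT x|lebesgue_on \<Omega>. l x * \<eta> x)"
    if "k \<in> Lp_loc \<Omega> 1" "l \<in> Lp_loc \<Omega> 1" "\<eta> \<in> test_functions \<Omega>" for k l \<eta>
    using integrable_mult_test_function[OF \<Omega> that(1,3)] integrable_mult_test_function[OF \<Omega> that(2,3)]
    by (simp add: distrib_right mult.assoc)
  have "(LINT x|lebesgue_on \<Omega>. v x * partial i \<phi> x) = - (LINT x|lebesgue_on \<Omega>. g x $ i * \<phi> x)"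
    "(LINT x|lebesgue_on \<Omega>. w x * partial i \<phi> x) = - (LINT x|lebesgue_on \<Omega>. h x $ i * \<phi> x)"
    using v w \<phi> by (auto simp: has_weak_gradient_def)
  then show "(LINT x|lebesgue_on \<Omega>. (a * v x + b * w x) * partial i \<phi> x) =
      - (LINT x|lebesgue_on \<Omega>. (a *\<^sub>R g x + b *\<^sub>R h x) $ i * \<phi> x)"
    using lin[OF loc(1,2) d\<phi>] lin[OF Lp_loc_nth[OF loc(3)] Lp_loc_nth[OF loc(4)] \<phi>] by simp
qed

text \<open>Both gradients have the same integrals against test functions, so the fundamental lemma
  applies to each component of the difference; there are finitely many components.\<close>

lemma has_weak_gradient_unique:
  fixes w :: "real^'n::finite \<Rightarrow> real"
  assumes \<Omega>: "open \<Omega>" and g: "has_weak_gradient \<Omega> w g" and h: "has_weak_gradient \<Omega> w h"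
  shows "AE x in lebesgue_on \<Omega>. g x = h x"
proof -
  have \<Omega>s: "\<Omega> \<in> sets lebesgue" using \<Omega> by (simp add: borel_open)
  have loc: "(\<lambda>x. g x $ i) \<in> Lp_loc \<Omega> 1" "(\<lambda>x. h x $ i) \<in> Lp_loc \<Omega> 1" for i
    using g h by (auto simp: has_weak_gradient_def intro: Lp_loc_nth)
  have "AE x in lebesgue_on \<Omega>. g x $ i - h x $ i = 0" for i
  proof (rule fundamental_lemma_calculus_of_variations[OF \<Omega>])
    show "(\<lambda>x. g x $ i - h x $ i) \<in> Lp_loc \<Omega> 1"
      using Lp_loc_lincomb[OF loc[of i], of 1 "-1"] by simp
    fix \<phi> assume \<phi>: "\<phi> \<in> test_functions \<Omega>"
    have "(LINT x|lebesgue_on \<Omega>. w x * partial i \<phi> x) = - (LINT x|lebesgue_on \<Omega>. g x $ i * \<phi> x)"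
      "(LINT x|lebesgue_on \<Omega>. w x * partial i \<phi> x) = - (LINT x|lebesgue_on \<Omega>. h x $ i * \<phi> x)"
      using g h \<phi> unfolding has_weak_gradient_def by blast+
    then have "(LINT x|lebesgue_on \<Omega>. g x $ i * \<phi> x) = (LINT x|lebesgue_on \<Omega>. h x $ i * \<phi> x)" by simp
    then show "(LINT x|lebesgue_on \<Omega>. (g x $ i - h x $ i) * \<phi> x) = 0"
      using integrable_mult_test_function[OF \<Omega>s loc(1) \<phi>] integrable_mult_test_function[OF \<Omega>s loc(2) \<phi>]
      by (simp add: left_diff_distrib)
  qed
  then have "AE x in lebesgue_on \<Omega>. \<forall>i. g x $ i - h x $ i = 0"
    by (intro eventually_all_finite)
  then show ?thesis by eventually_elim (simp add: vec_eq_iff)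
qed

text \<open>The gradient picked by \<open>SOME\<close> need not be the p-integrable one that
  witnesses membership, but the two agree almost everywhere, and p-integrability carries
  over.\<close>

lemma sobolev_weak_gradient:
  assumes \<Omega>: "open \<Omega>" and w: "w \<in> sobolev \<Omega> p"
  shows "has_weak_gradient \<Omega> w (weak_gradient \<Omega> w)" "weak_gradient \<Omega> w \<in> Lp \<Omega> p"
proof -
  obtain g where g: "has_weak_gradient \<Omega> w g" "g \<in> Lp \<Omega> p" using w by (auto simp: sobolev_def)
  show *: "has_weak_gradient \<Omega> w (weak_gradient \<Omega> w)"
    unfolding weak_gradient_def by (rule someI[of "has_weak_gradient \<Omega> w", OF g(1)])
  show "weak_gradient \<Omega> w \<in> Lp \<Omega> p"
    using Lp_AE[OF _ g(2) has_weak_gradient_unique[OF \<Omega> g(1) *]] \<Omega> by (simp add: borel_open)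
qed

lemma sobolev_Lp: "w \<in> sobolev \<Omega> p \<Longrightarrow> w \<in> Lp \<Omega> p"
  by (simp add: sobolev_def)

lemma sobolev_lincomb:
  assumes \<Omega>: "open \<Omega>" and p: "p \<ge> 1" and v: "v \<in> sobolev \<Omega> p" and w: "w \<in> sobolev \<Omega> p"
  shows "(\<lambda>x. a * v x + b * w x) \<in> sobolev \<Omega> p"
    and "AE x in lebesgue_on \<Omega>. weak_gradient \<Omega> (\<lambda>x. a * v x + b * w x) x =
           a *\<^sub>R weak_gradient \<Omega> v x + b *\<^sub>R weak_gradient \<Omega> w x"
proof -
  have \<Omega>s: "\<Omega> \<in> sets lebesgue" using \<Omega> by (simp add: borel_open)
  note gv = sobolev_weak_gradient[OF \<Omega> v] and gw = sobolev_weak_gradient[OF \<Omega> w]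
  note lin = has_weak_gradient_lincomb[OF \<Omega>s gv(1) gw(1), of a b]
  have "(\<lambda>x. a * v x + b * w x) \<in> Lp \<Omega> p"
    using Lp_add[OF p Lp_scale[OF sobolev_Lp[OF v]] Lp_scale[OF sobolev_Lp[OF w]], of a b] by simp
  moreover have "(\<lambda>x. a *\<^sub>R weak_gradient \<Omega> v x + b *\<^sub>R weak_gradient \<Omega> w x) \<in> Lp \<Omega> p"
    using Lp_add[OF p Lp_scale[OF gv(2)] Lp_scale[OF gw(2)]] .
  ultimately show S: "(\<lambda>x. a * v x + b * w x) \<in> sobolev \<Omega> p" using lin by (auto simp: sobolev_def)
  show "AE x in lebesgue_on \<Omega>. weak_gradient \<Omega> (\<lambda>x. a * v x + b * w x) x =
           a *\<^sub>R weak_gradient \<Omega> v x + b *\<^sub>R weak_gradient \<Omega> w x"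
    by (rule has_weak_gradient_unique[OF \<Omega> sobolev_weak_gradient(1)[OF \<Omega> S] lin])
qed

lemma subspace_sobolev:
  assumes \<Omega>: "open \<Omega>" and p: "p \<ge> 1"
  shows "subspace (sobolev \<Omega> p)"
proof -
  have \<Omega>s: "\<Omega> \<in> sets lebesgue" using \<Omega> by (simp add: borel_open)
  have "(\<lambda>x. 0) \<in> test_functions \<Omega>"
    by (rule test_functionsI[of _ "{}", OF C_k_const]) simp_all
  from test_function_sobolev[OF \<Omega>s this, of p] have 0: "(\<lambda>x. 0) \<in> sobolev \<Omega> p" using p by simp
  show ?thesis
    unfolding subspace_def
  proof (intro conjI ballI allI)
    show "0 \<in> sobolev \<Omega> p" using 0 by (simp add: zero_fun_def)
    show "v + w \<in> sobolev \<Omega> p" if "v \<in> sobolev \<Omega> p" "w \<in> sobolev \<Omega> p" for v w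
      using sobolev_lincomb(1)[OF \<Omega> p that, of 1 1] by (simp add: plus_fun_def)
    show "c *\<^sub>R v \<in> sobolev \<Omega> p" if "v \<in> sobolev \<Omega> p" for c v
      using sobolev_lincomb(1)[OF \<Omega> p that 0, of c 0] by (simp add: scaleR_fun_def)
  qed
qed

text \<open>The combination is prescribed only almost everywhere because \<open>k\<close> will be
  the chosen weak gradient of a convex combination, which is linear only up to a null set.\<close>

lemma integral_norm_powr_lincomb_le:
  assumes p: "p \<ge> 1" and st: "0 \<le> s" "0 \<le> t" "s + t = 1"
    and g: "g \<in> Lp \<Omega> p" and h: "h \<in> Lp \<Omega> p" and k: "k \<in> Lp \<Omega> p"
    and ae: "AE x in lebesgue_on \<Omega>. k x = s *\<^sub>R g x + t *\<^sub>R h x"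
  shows "(LINT x|lebesgue_on \<Omega>. norm (k x) powr p)
    \<le> s * (LINT x|lebesgue_on \<Omega>. norm (g x) powr p) + t * (LINT x|lebesgue_on \<Omega>. norm (h x) powr p)"
proof -
  have i: "integrable (lebesgue_on \<Omega>) (\<lambda>x. norm (g x) powr p)" "integrable (lebesgue_on \<Omega>) (\<lambda>x. norm (h x) powr p)"
    "integrable (lebesgue_on \<Omega>) (\<lambda>x. norm (k x) powr p)"
    using g h k by (auto simp: Lp_def)
  have "(LINT x|lebesgue_on \<Omega>. norm (k x) powr p)
      \<le> (LINT x|lebesgue_on \<Omega>. s * norm (g x) powr p + t * norm (h x) powr p)"
  proof (rule integral_mono_AE)
    show "AE x in lebesgue_on \<Omega>. norm (k x) powr p \<le> s * norm (g x) powr p + t * norm (h x) powr p"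
      using ae by eventually_elim (simp add: norm_powr_convex[OF p st])
  qed (use i in auto)
  also have "\<dots> = s * (LINT x|lebesgue_on \<Omega>. norm (g x) powr p) + t * (LINT x|lebesgue_on \<Omega>. norm (h x) powr p)"
    using i by simp
  finally show ?thesis .
qed

text \<open>The sum of the two integrals, before the root is taken, is convex and homogeneous of
  degree p; this is what the abstract Minkowski inequality asks for.\<close>

lemma seminorm_sobolev_norm:
  fixes \<Omega> :: "(real^'n::finite) set"
  assumes \<Omega>: "open \<Omega>" and p: "p \<ge> 1"
  shows "seminorm_on (sobolev \<Omega> p) (sobolev_norm \<Omega> p)"
proof -
  have eq: "sobolev_norm \<Omega> p = (\<lambda>w. ((LINT x|lebesgue_on \<Omega>. norm (w x) powr p) +
      (LINT x|lebesgue_on \<Omega>. norm (weak_gradient \<Omega> w x) powr p)) powr (1 / p))"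
    by (auto simp: sobolev_norm_def)
  show ?thesis unfolding eq
  proof (rule seminorm_on_convex_homogeneous_powr[OF subspace_sobolev[OF \<Omega> p]])
    show "p > 0" using p by simp
    show "0 \<le> (LINT x|lebesgue_on \<Omega>. norm (w x) powr p) + (LINT x|lebesgue_on \<Omega>. norm (weak_gradient \<Omega> w x) powr p)" for w
      by (intro add_nonneg_nonneg Bochner_Integration.integral_nonneg) auto
    show "(LINT x|lebesgue_on \<Omega>. norm ((c *\<^sub>R w) x) powr p) + (LINT x|lebesgue_on \<Omega>. norm (weak_gradient \<Omega> (c *\<^sub>R w) x) powr p)
      = \<bar>c\<bar> powr p * ((LINT x|lebesgue_on \<Omega>. norm (w x) powr p) + (LINT x|lebesgue_on \<Omega>. norm (weak_gradient \<Omega> w x) powr p))"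
      if w: "w \<in> sobolev \<Omega> p" for c w
    proof -
      have cw: "c *\<^sub>R w = (\<lambda>x. c * w x + 0 * w x)" by (simp add: scaleR_fun_def)
      have S: "c *\<^sub>R w \<in> sobolev \<Omega> p" unfolding cw by (rule sobolev_lincomb(1)[OF \<Omega> p w w])
      have ae: "AE x in lebesgue_on \<Omega>. weak_gradient \<Omega> (c *\<^sub>R w) x = c *\<^sub>R weak_gradient \<Omega> w x"
        using sobolev_lincomb(2)[OF \<Omega> p w w, of c 0] unfolding cw by simp
      have [measurable]: "weak_gradient \<Omega> (c *\<^sub>R w) \<in> borel_measurable (lebesgue_on \<Omega>)"
        "weak_gradient \<Omega> w \<in> borel_measurable (lebesgue_on \<Omega>)"
        using sobolev_weak_gradient(2)[OF \<Omega> S] sobolev_weak_gradient(2)[OF \<Omega> w] by (auto simp: Lp_def)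
      have "(LINT x|lebesgue_on \<Omega>. norm (weak_gradient \<Omega> (c *\<^sub>R w) x) powr p)
          = (LINT x|lebesgue_on \<Omega>. \<bar>c\<bar> powr p * norm (weak_gradient \<Omega> w x) powr p)"
      proof (rule integral_cong_AE)
        show "AE x in lebesgue_on \<Omega>. norm (weak_gradient \<Omega> (c *\<^sub>R w) x) powr p = \<bar>c\<bar> powr p * norm (weak_gradient \<Omega> w x) powr p"
          using ae by eventually_elim (simp add: powr_mult)
      qed measurable
      then show ?thesis by (simp add: scaleR_fun_def powr_mult abs_mult distrib_left)
    qed
    fix s t :: real and v w
    assume vw: "v \<in> sobolev \<Omega> p" "w \<in> sobolev \<Omega> p" and st: "0 \<le> s" "0 \<le> t" "s + t = 1"
    have c: "s *\<^sub>R v + t *\<^sub>R w = (\<lambda>x. s * v x + t * w x)" by (simp add: scaleR_fun_def plus_fun_def)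
    note S = sobolev_lincomb[OF \<Omega> p vw, of s t, folded c]
    have "(LINT x|lebesgue_on \<Omega>. norm ((s *\<^sub>R v + t *\<^sub>R w) x) powr p)
        \<le> s * (LINT x|lebesgue_on \<Omega>. norm (v x) powr p) + t * (LINT x|lebesgue_on \<Omega>. norm (w x) powr p)"
      by (rule integral_norm_powr_lincomb_le[OF p st sobolev_Lp[OF vw(1)] sobolev_Lp[OF vw(2)] sobolev_Lp[OF S(1)]])
        (simp add: c)
    moreover have "(LINT x|lebesgue_on \<Omega>. norm (weak_gradient \<Omega> (s *\<^sub>R v + t *\<^sub>R w) x) powr p)
        \<le> s * (LINT x|lebesgue_on \<Omega>. norm (weak_gradient \<Omega> v x) powr p) + t * (LINT x|lebesgue_on \<Omega>. norm (weak_gradient \<Omega> w x) powr p)"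
      by (rule integral_norm_powr_lincomb_le[OF p st sobolev_weak_gradient(2)[OF \<Omega> vw(1)]
            sobolev_weak_gradient(2)[OF \<Omega> vw(2)] sobolev_weak_gradient(2)[OF \<Omega> S(1)] S(2)])
    ultimately show "(LINT x|lebesgue_on \<Omega>. norm ((s *\<^sub>R v + t *\<^sub>R w) x) powr p) +
        (LINT x|lebesgue_on \<Omega>. norm (weak_gradient \<Omega> (s *\<^sub>R v + t *\<^sub>R w) x) powr p)
      \<le> s * ((LINT x|lebesgue_on \<Omega>. norm (v x) powr p) + (LINT x|lebesgue_on \<Omega>. norm (weak_gradient \<Omega> v x) powr p)) +
        t * ((LINT x|lebesgue_on \<Omega>. norm (w x) powr p) + (LINT x|lebesgue_on \<Omega>. norm (weak_gradient \<Omega> w x) powr p))"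
      by (simp add: distrib_left)
  qed
qed


section \<open>Convexity of the obstacle problem and relaxation\<close>

text \<open>Combining the two approximating test functions with the same weights gives an error at
  most the weighted mean of the two errors, still below the same bound e.\<close>

lemma sobolev0_convex_combination:
  assumes \<Omega>: "open \<Omega>" and p: "p \<ge> 1" and st: "0 \<le> s" "0 \<le> t" "s + t = 1"
    and v: "v \<in> sobolev0 \<Omega> p" and w: "w \<in> sobolev0 \<Omega> p"
  shows "(\<lambda>x. s * v x + t * w x) \<in> sobolev0 \<Omega> p"
proof -
  have \<Omega>s: "\<Omega> \<in> sets lebesgue" using \<Omega> by (simp add: borel_open)
  have S: "v \<in> sobolev \<Omega> p" "w \<in> sobolev \<Omega> p" using v w by (auto simp: sobolev0_def)
  have N: "seminorm_on (sobolev \<Omega> p) (sobolev_norm \<Omega> p)" by (rule seminorm_sobolev_norm[OF \<Omega> p])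
  have "\<exists>\<phi>\<in>test_functions \<Omega>. sobolev_norm \<Omega> p (\<lambda>x. (s * v x + t * w x) - \<phi> x) < e" if e: "e > 0" for e
  proof -
    obtain \<phi> where \<phi>: "\<phi> \<in> test_functions \<Omega>" "sobolev_norm \<Omega> p (\<lambda>x. v x - \<phi> x) < e"
      using v e unfolding sobolev0_def by blast
    obtain \<eta> where \<eta>: "\<eta> \<in> test_functions \<Omega>" "sobolev_norm \<Omega> p (\<lambda>x. w x - \<eta> x) < e"
      using w e unfolding sobolev0_def by blast
    have "\<phi> \<in> sobolev \<Omega> p" "\<eta> \<in> sobolev \<Omega> p"
      using test_function_sobolev[OF \<Omega>s] \<phi> \<eta> p by auto
    then have D: "(\<lambda>x. v x - \<phi> x) \<in> sobolev \<Omega> p" "(\<lambda>x. w x - \<eta> x) \<in> sobolev \<Omega> p"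
      using sobolev_lincomb(1)[OF \<Omega> p, of _ _ 1 "-1"] S by simp_all
    note sc = subspace_scale[OF subspace_sobolev[OF \<Omega> p]]
    let ?\<zeta> = "\<lambda>x. s * \<phi> x + t * \<eta> x"
    have eq: "(\<lambda>x. (s * v x + t * w x) - ?\<zeta> x) = s *\<^sub>R (\<lambda>x. v x - \<phi> x) + t *\<^sub>R (\<lambda>x. w x - \<eta> x)"
      by (auto simp: scaleR_fun_def plus_fun_def algebra_simps)
    have "sobolev_norm \<Omega> p (\<lambda>x. (s * v x + t * w x) - ?\<zeta> x)
        \<le> sobolev_norm \<Omega> p (s *\<^sub>R (\<lambda>x. v x - \<phi> x)) + sobolev_norm \<Omega> p (t *\<^sub>R (\<lambda>x. w x - \<eta> x))"
      unfolding eq using N sc[OF D(1)] sc[OF D(2)] unfolding seminorm_on_def by blast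
    also have "\<dots> = s * sobolev_norm \<Omega> p (\<lambda>x. v x - \<phi> x) + t * sobolev_norm \<Omega> p (\<lambda>x. w x - \<eta> x)"
      using N D st(1,2) unfolding seminorm_on_def by simp
    also have "\<dots> < e"
      using convex_bound_lt[OF \<phi>(2) \<eta>(2) st] by simp
    finally show ?thesis by (rule bexI[OF _ test_functions_lincomb[OF \<phi>(1) \<eta>(1)]])
  qed
  then show ?thesis using sobolev_lincomb(1)[OF \<Omega> p S] by (auto simp: sobolev0_def)
qed

text \<open>Because the weights add up to 1, the boundary value reproduces itself. A convex
  combination lies above the smaller of the two functions, hence above the obstacle.\<close>

lemma obstacle_class_convex_combination:
  assumes \<Omega>: "open \<Omega>" and q: "q \<ge> 1" and st: "0 \<le> s" "0 \<le> t" "s + t = 1"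
    and v: "v \<in> obstacle_class \<Omega> q u\<^sub>0 \<psi>" and w: "w \<in> obstacle_class \<Omega> q u\<^sub>0 \<psi>"
  shows "(\<lambda>x. s * v x + t * w x) \<in> obstacle_class \<Omega> q u\<^sub>0 \<psi>"
proof -
  have "(\<lambda>x. s * (v x - u\<^sub>0 x) + t * (w x - u\<^sub>0 x)) \<in> sobolev0 \<Omega> q"
    using v w by (intro sobolev0_convex_combination[OF \<Omega> q st]) (auto simp: obstacle_class_def)
  also have "(\<lambda>x. s * (v x - u\<^sub>0 x) + t * (w x - u\<^sub>0 x)) = (\<lambda>x. (s * v x + t * w x) - u\<^sub>0 x)"
  proof
    fix x
    have "s * u\<^sub>0 x + t * u\<^sub>0 x = u\<^sub>0 x" using st by (metis distrib_right mult_1)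
    then show "s * (v x - u\<^sub>0 x) + t * (w x - u\<^sub>0 x) = (s * v x + t * w x) - u\<^sub>0 x"
      by (simp add: algebra_simps)
  qed
  finally have 1: "(\<lambda>x. (s * v x + t * w x) - u\<^sub>0 x) \<in> sobolev0 \<Omega> q" .
  have "AE x in lebesgue_on \<Omega>. \<psi> x \<le> ereal (v x)" "AE x in lebesgue_on \<Omega>. \<psi> x \<le> ereal (w x)"
    using v w by (auto simp: obstacle_class_def)
  then have "AE x in lebesgue_on \<Omega>. \<psi> x \<le> ereal (s * v x + t * w x)"
  proof eventually_elim
    case (elim x)
    \<comment> \<open>The upper bound for convex combinations is used on the negatives. Comparing
      with the minimum keeps weights away from the obstacle, whose value may be infinite.\<close>
    have "- (s * v x + t * w x) \<le> - min (v x) (w x)"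
      using convex_bound_le[of "- v x" "- min (v x) (w x)" "- w x" s t] st by simp
    moreover have "\<psi> x \<le> ereal (min (v x) (w x))" using elim by (simp add: min_def)
    ultimately show ?case by (meson ereal_less_eq(3) neg_le_iff_le order_trans)
  qed
  with 1 show ?thesis by (simp add: obstacle_class_def)
qed

text \<open>For a simple function in place of \<open>g\<close> the composition is pieced together
  from finitely many measurable sections of \<open>f\<close>. Continuity in the second variable
  passes this to the pointwise limit of simple functions.\<close>

lemma caratheodory_measurable:
  fixes f :: "real^'n::finite \<Rightarrow> real^'n \<Rightarrow> real"
  assumes \<Omega>: "\<Omega> \<in> sets lebesgue" and f: "caratheodory \<Omega> f"
    and g: "g \<in> borel_measurable (lebesgue_on \<Omega>)"
  shows "(\<lambda>x. f x (g x)) \<in> borel_measurable (lebesgue_on \<Omega>)"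
proof -
  obtain s where s: "\<And>i. simple_function (lebesgue_on \<Omega>) (s i)"
    and lim: "\<And>x. x \<in> space (lebesgue_on \<Omega>) \<Longrightarrow> (\<lambda>i. s i x) \<longlonglongrightarrow> g x"
    using borel_measurable_implies_sequence_metric[OF g, of 0] by blast
  have fm: "(\<lambda>x. f x \<xi>) \<in> borel_measurable (lebesgue_on \<Omega>)" for \<xi>
    using f by (simp add: caratheodory_def)
  have m: "(\<lambda>x. f x (s i x)) \<in> borel_measurable (lebesgue_on \<Omega>)" for i
  proof (rule measurable_compose_countable'[where f = "\<lambda>\<xi> x. f x \<xi>" and I = "s i ` space (lebesgue_on \<Omega>)"])
    have "finite (s i ` space (lebesgue_on \<Omega>))" using s[of i] by (rule simple_functionD)
    then show "countable (s i ` space (lebesgue_on \<Omega>))" by (rule countable_finite)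
    show "s i \<in> measurable (lebesgue_on \<Omega>) (count_space (s i ` space (lebesgue_on \<Omega>)))"
      using s[of i] \<open>finite _\<close> by (subst measurable_count_space_eq2) (auto simp: simple_function_def)
  qed (rule fm)
  \<comment> \<open>Convergence is known only where \<open>f x\<close> is continuous, so
    \<open>lim\<close> provides a measurable function everywhere, equal to the desired one almost
    everywhere.\<close>
  have "(\<lambda>x. lim (\<lambda>i. f x (s i x))) \<in> borel_measurable (lebesgue_on \<Omega>)"
    using m by (rule borel_measurable_lim_metric)
  moreover have "AE x in lebesgue_on \<Omega>. lim (\<lambda>i. f x (s i x)) = f x (g x)"
  proof -
    have "AE x in lebesgue_on \<Omega>. continuous_on UNIV (f x)" using f by (simp add: caratheodory_def)
    then show ?thesis using AE_space
    proof eventually_elim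
      case (elim x)
      then have "isCont (f x) (g x)" by (simp add: continuous_on_eq_continuous_at)
      then have "(\<lambda>i. f x (s i x)) \<longlonglongrightarrow> f x (g x)"
        using lim[OF elim(2)] by (rule isCont_tendsto_compose)
      then show ?case by (rule limI)
    qed
  qed
  ultimately show ?thesis by (rule borel_measurable_lebesgue_on_AE[OF \<Omega>])
qed

text \<open>Convexity of the integrand is applied pointwise after replacing the gradient of the
  combination by the combination of gradients, both off a null set. The measurability of the two
  compositions is what splits the integral.\<close>

lemma energy_convex_combination:
  assumes \<Omega>: "open \<Omega>" and p: "p \<ge> 1" and st: "0 \<le> s" "0 \<le> t" "s + t = 1"
    and nonneg: "\<forall>x\<in>\<Omega>. \<forall>\<xi>. 0 \<le> f x \<xi>" and car: "caratheodory \<Omega> f"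
    and conv: "AE x in lebesgue_on \<Omega>. convex_on UNIV (f x)"
    and v: "v \<in> sobolev \<Omega> p" and w: "w \<in> sobolev \<Omega> p"
  shows "energy \<Omega> f (\<lambda>x. s * v x + t * w x) \<le> ennreal s * energy \<Omega> f v + ennreal t * energy \<Omega> f w"
proof -
  have \<Omega>s: "\<Omega> \<in> sets lebesgue" using \<Omega> by (simp add: borel_open)
  have [measurable]: "weak_gradient \<Omega> v \<in> borel_measurable (lebesgue_on \<Omega>)"
    "weak_gradient \<Omega> w \<in> borel_measurable (lebesgue_on \<Omega>)"
    using sobolev_weak_gradient(2)[OF \<Omega> v] sobolev_weak_gradient(2)[OF \<Omega> w] by (auto simp: Lp_def)
  have [measurable]: "(\<lambda>x. f x (weak_gradient \<Omega> v x)) \<in> borel_measurable (lebesgue_on \<Omega>)"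
    "(\<lambda>x. f x (weak_gradient \<Omega> w x)) \<in> borel_measurable (lebesgue_on \<Omega>)"
    by (rule caratheodory_measurable[OF \<Omega>s car]; measurable)+
  have "energy \<Omega> f (\<lambda>x. s * v x + t * w x) \<le>
      (\<integral>\<^sup>+ x. ennreal s * ennreal (f x (weak_gradient \<Omega> v x)) + ennreal t * ennreal (f x (weak_gradient \<Omega> w x)) \<partial>lebesgue_on \<Omega>)"
    unfolding energy_def
  proof (rule nn_integral_mono_AE)
    show "AE x in lebesgue_on \<Omega>. ennreal (f x (weak_gradient \<Omega> (\<lambda>x. s * v x + t * w x) x))
      \<le> ennreal s * ennreal (f x (weak_gradient \<Omega> v x)) + ennreal t * ennreal (f x (weak_gradient \<Omega> w x))"
      using conv sobolev_lincomb(2)[OF \<Omega> p v w, of s t] AE_space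
    proof eventually_elim
      case (elim x)
      have x: "x \<in> \<Omega>" using elim(3) by simp
      have s: "s = 1 - t" using st by simp
      have "f x (s *\<^sub>R weak_gradient \<Omega> v x + t *\<^sub>R weak_gradient \<Omega> w x)
          \<le> s * f x (weak_gradient \<Omega> v x) + t * f x (weak_gradient \<Omega> w x)"
        using convex_onD[OF elim(1), of t "weak_gradient \<Omega> v x" "weak_gradient \<Omega> w x"] st unfolding s by simp
      then have "ennreal (f x (weak_gradient \<Omega> (\<lambda>x. s * v x + t * w x) x))
          \<le> ennreal (s * f x (weak_gradient \<Omega> v x) + t * f x (weak_gradient \<Omega> w x))"
        unfolding elim(2) by (rule ennreal_leI)
      then show ?case using nonneg x st by (simp add: ennreal_mult)
    qed
  qed
  also have "\<dots> = ennreal s * energy \<Omega> f v + ennreal t * energy \<Omega> f w"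
    unfolding energy_def by (subst nn_integral_add) (auto simp: nn_integral_cmult)
  finally show ?thesis .
qed

section \<open>Strong and weak convergence, and Mazur's lemma\<close>

lemma weakly_converges_if_sobolev_norm_tendsto_0:
  assumes \<Omega>: "open \<Omega>" and p: "p \<ge> 1" and u: "u \<in> sobolev \<Omega> p" and v: "\<And>k. v k \<in> sobolev \<Omega> p"
    and lim: "(\<lambda>k. sobolev_norm \<Omega> p (u - v k)) \<longlonglongrightarrow> 0"
  shows "weakly_converges \<Omega> p v u"
  unfolding weakly_converges_def
proof (intro conjI allI ballI)
  fix l assume l: "l \<in> sobolev_dual \<Omega> p"
  obtain B where B: "\<And>w. w \<in> sobolev \<Omega> p \<Longrightarrow> \<bar>l w\<bar> \<le> B * sobolev_norm \<Omega> p w"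
    using l unfolding sobolev_dual_def by blast
  have V: "subspace (sobolev \<Omega> p)" by (rule subspace_sobolev[OF \<Omega> p])
  have diff: "l (u - v k) = l u - l (v k)" for k
  proof -
    have "l (\<lambda>x. (u - v k) x + v k x) = l (u - v k) + l (v k)"
      using l subspace_diff[OF V u v] v unfolding sobolev_dual_def by blast
    then show ?thesis by (simp add: fun_diff_def)
  qed
  have "(\<lambda>k. l (u - v k)) \<longlonglongrightarrow> 0"
  proof (rule Lim_null_comparison)
    show "\<forall>\<^sub>F k in sequentially. norm (l (u - v k)) \<le> B * sobolev_norm \<Omega> p (u - v k)"
      using B subspace_diff[OF V u v] by (intro always_eventually) simp
    show "(\<lambda>k. B * sobolev_norm \<Omega> p (u - v k)) \<longlonglongrightarrow> 0"
      using lim by (rule tendsto_mult_right_zero)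
  qed
  then have "(\<lambda>k. l u - (l u - l (v k))) \<longlonglongrightarrow> l u - 0"
    unfolding diff by (intro tendsto_diff tendsto_const)
  then show "(\<lambda>k. l (v k)) \<longlonglongrightarrow> l u" by simp
qed (use u v in auto)

text \<open>If \<open>C\<close> kept distance e from u, a separating functional would stay at most l
  u - e on \<open>C\<close>. Being bounded by the norm it lies in the dual, so its values along the
  sequence tend to l u, which forbids infinitely many visits to \<open>C\<close>. Frequent
  membership suffices, so no subsequence is extracted.\<close>

lemma mazur_sobolev:
  assumes \<Omega>: "open \<Omega>" and p: "p \<ge> 1" and U: "weakly_converges \<Omega> p U u"
    and C: "convex C" "C \<subseteq> sobolev \<Omega> p" and freq: "\<exists>\<^sub>F j in sequentially. U j \<in> C" and e: "e > 0"
  shows "\<exists>v\<in>C. sobolev_norm \<Omega> p (u - v) < e"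
proof (rule ccontr)
  assume "\<not> ?thesis"
  then have dist: "\<forall>c\<in>C. e \<le> sobolev_norm \<Omega> p (u - c)" by force
  have u: "u \<in> sobolev \<Omega> p" using U by (simp add: weakly_converges_def)
  have "C \<noteq> {}" using freq frequently_ex by force
  obtain l where l: "\<And>x y. x \<in> sobolev \<Omega> p \<Longrightarrow> y \<in> sobolev \<Omega> p \<Longrightarrow> l (x + y) = l x + l y"
    "\<And>c x. x \<in> sobolev \<Omega> p \<Longrightarrow> l (c *\<^sub>R x) = c * l x" "\<And>x. x \<in> sobolev \<Omega> p \<Longrightarrow> \<bar>l x\<bar> \<le> sobolev_norm \<Omega> p x"
    "\<And>c. c \<in> C \<Longrightarrow> l c \<le> l u - e"
    by (rule seminorm_separation[OF subspace_sobolev[OF \<Omega> p] seminorm_sobolev_norm[OF \<Omega> p] C(2,1) \<open>C \<noteq> {}\<close> u dist])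
      blast
  have "l \<in> sobolev_dual \<Omega> p"
    unfolding sobolev_dual_def using l(1,2)
    by (auto simp: plus_fun_def scaleR_fun_def intro!: exI[of _ 1] l(3))
  then have "(\<lambda>j. l (U j)) \<longlonglongrightarrow> l u" using U by (simp add: weakly_converges_def)
  then have "\<forall>\<^sub>F j in sequentially. l u - e < l (U j)" using e by (intro order_tendstoD) auto
  then have "\<forall>\<^sub>F j in sequentially. U j \<notin> C" by eventually_elim (use l(4) in force)
  then show False using freq by (simp add: frequently_def)
qed

lemma liminf_less_frequently:
  fixes x :: "nat \<Rightarrow> 'a::complete_linorder"
  assumes "liminf x < c"
  shows "\<exists>\<^sub>F j in sequentially. x j < c"
proof (rule ccontr)
  assume "\<not> ?thesis"
  then have "\<forall>\<^sub>F j in sequentially. c \<le> x j" by (simp add: frequently_def not_less)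
  then have "c \<le> liminf x" by (rule Liminf_bounded)
  then show False using assms by simp
qed

theorem lemma5p1:
  fixes \<Omega> :: "(real^'n) set"
    and p q r \<nu> L :: real
    and f :: "real^'n \<Rightarrow> real^'n \<Rightarrow> real"
    and fx\<xi> :: "real^'n \<Rightarrow> real^'n \<Rightarrow> real^'n^'n"
    and h u\<^sub>0 :: "real^'n \<Rightarrow> real"
    and \<psi> :: "real^'n \<Rightarrow> ereal"
  assumes "CARD('n) \<ge> 2"
    and "open \<Omega>" and "bounded \<Omega>"
    and "r > CARD('n)" and "q > p" and "p \<ge> 2"
    and "1 \<le> q / p" and "q / p < 1 + 1 / CARD('n) - 1 / r"
    and "\<forall>x\<in>\<Omega>. \<forall>\<xi>. 0 \<le> f x \<xi>"
    and "caratheodory \<Omega> f"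
    and "AE x in lebesgue_on \<Omega>. convex_on UNIV (f x)"
    and "AE x in lebesgue_on \<Omega>. C_k 2 (f x)"
    and "\<nu> > 0" and "L > 0"
    and "\<forall>x\<in>\<Omega>. 0 \<le> h x" and "h \<in> Lp_loc \<Omega> r"
    and "AE x in lebesgue_on \<Omega>. \<forall>\<xi>.
           \<nu> * (1 + (norm \<xi>)\<^sup>2) powr (p / 2) \<le> f x \<xi> \<and>
           f x \<xi> \<le> L * (1 + (norm \<xi>)\<^sup>2) powr (q / 2)"
    and "AE x in lebesgue_on \<Omega>. \<forall>\<xi> l.
           \<nu> * (1 + (norm \<xi>)\<^sup>2) powr ((p - 2) / 2) * (norm l)\<^sup>2
             \<le> (\<Sum>i\<in>UNIV. \<Sum>j\<in>UNIV. partial j (partial i (f x)) \<xi> * l $ i * l $ j) \<and>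
           (\<Sum>i\<in>UNIV. \<Sum>j\<in>UNIV. partial j (partial i (f x)) \<xi> * l $ i * l $ j)
             \<le> L * (1 + (norm \<xi>)\<^sup>2) powr ((q - 2) / 2) * (norm l)\<^sup>2"
    and "\<forall>\<xi> i. has_weak_gradient \<Omega> (\<lambda>x. partial i (f x) \<xi>) (\<lambda>x. fx\<xi> x \<xi> $ i)"
    and "AE x in lebesgue_on \<Omega>. \<forall>\<xi>.
           norm (fx\<xi> x \<xi>) \<le> h x * (1 + (norm \<xi>)\<^sup>2) powr ((q - 1) / 2)"
    and "sobolev_obstacle \<Omega> p \<psi>"
    and "u\<^sub>0 \<in> sobolev \<Omega> q"
    and "obstacle_class \<Omega> p u\<^sub>0 \<psi> \<noteq> {}"
  shows "\<forall>u\<in>obstacle_class \<Omega> p u\<^sub>0 \<psi>. approximations \<Omega> p q u\<^sub>0 \<psi> u \<noteq> {} \<longrightarrow>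
           (\<exists>U. (\<forall>k. U k \<in> obstacle_class \<Omega> q u\<^sub>0 \<psi>) \<and>
                weakly_converges \<Omega> p U u \<and>
                (\<lambda>k. energy \<Omega> f (U k)) \<longlonglongrightarrow> relaxed_energy \<Omega> p q f u\<^sub>0 \<psi> u)"
proof (intro ballI impI)
  fix u assume "approximations \<Omega> p q u\<^sub>0 \<psi> u \<noteq> {}"
  then obtain U\<^sub>0 where U\<^sub>0: "U\<^sub>0 \<in> approximations \<Omega> p q u\<^sub>0 \<psi> u" by blast
  let ?R = "relaxed_energy \<Omega> p q f u\<^sub>0 \<psi> u"
  let ?K = "obstacle_class \<Omega> q u\<^sub>0 \<psi>"
  let ?\<epsilon> = "\<lambda>m. inverse (real (Suc m))"
  have p: "p \<ge> 1" and q: "q \<ge> 1" using \<open>q > p\<close> \<open>p \<ge> 2\<close> by auto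
  have le_liminf: "?R \<le> liminf (\<lambda>k. energy \<Omega> f (U k))"
    if "U \<in> approximations \<Omega> p q u\<^sub>0 \<psi> u" for U
    unfolding relaxed_energy_def using that by (rule INF_lower)
  have u: "u \<in> sobolev \<Omega> p" using U\<^sub>0 by (auto simp: approximations_def weakly_converges_def)
  \<comment> \<open>Only the upper bound is at stake, since every admissible sequence has limes
    inferior at least \<open>?R\<close>. If \<open>?R\<close> is infinite, any admissible sequence
    will do.\<close>
  have "\<exists>U\<in>approximations \<Omega> p q u\<^sub>0 \<psi> u. limsup (\<lambda>k. energy \<Omega> f (U k)) \<le> ?R"
  proof (cases "?R = \<infinity>")
    case True
    then show ?thesis using U\<^sub>0 by auto
  next
    case False
    have "\<exists>v \<in> ?K \<inter> sobolev \<Omega> p. energy \<Omega> f v \<le> ?R + ennreal (?\<epsilon> m) \<and> sobolev_norm \<Omega> p (u - v) < ?\<epsilon> m" for m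
    proof -
      \<comment> \<open>Intersecting with W^{1,p} makes the p-norm available on the sublevel set;
        admissible sequences lie there because weak convergence includes it.\<close>
      let ?C = "{v \<in> ?K \<inter> sobolev \<Omega> p. energy \<Omega> f v \<le> ?R + ennreal (?\<epsilon> m)}"
      \<comment> \<open>Finiteness of \<open>?R\<close> makes this strict, so some admissible
        sequence has limes inferior below the level and enters the sublevel set infinitely
        often.\<close>
      have "?R < ?R + ennreal (?\<epsilon> m)" using False by (simp add: ennreal_add_left_cancel_less)
      then obtain U where U: "U \<in> approximations \<Omega> p q u\<^sub>0 \<psi> u"
        and less: "liminf (\<lambda>j. energy \<Omega> f (U j)) < ?R + ennreal (?\<epsilon> m)"
        unfolding relaxed_energy_def INF_less_iff by blast
      have UK: "\<And>j. U j \<in> ?K \<inter> sobolev \<Omega> p" and Uu: "weakly_converges \<Omega> p U u"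
        using U by (auto simp: approximations_def weakly_converges_def)
      have "\<exists>\<^sub>F j in sequentially. U j \<in> ?C"
        using liminf_less_frequently[OF less] by (rule frequently_elim1) (use UK in auto)
      moreover have "convex ?C"
        unfolding convex_def
      proof (intro ballI allI impI)
        fix v w and s t :: real
        assume vw: "v \<in> ?C" "w \<in> ?C" and st: "0 \<le> s" "0 \<le> t" "s + t = 1"
        have eq: "s *\<^sub>R v + t *\<^sub>R w = (\<lambda>x. s * v x + t * w x)" by (simp add: scaleR_fun_def plus_fun_def)
        have "energy \<Omega> f (\<lambda>x. s * v x + t * w x) \<le> ennreal s * energy \<Omega> f v + ennreal t * energy \<Omega> f w"
          by (rule energy_convex_combination[OF \<open>open \<Omega>\<close> p st assms(9-11)]) (use vw in auto)
        also have "\<dots> \<le> ennreal s * (?R + ennreal (?\<epsilon> m)) + ennreal t * (?R + ennreal (?\<epsilon> m))"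
          using vw by (intro add_mono mult_left_mono) auto
        also have "\<dots> = ennreal (s + t) * (?R + ennreal (?\<epsilon> m))"
          using ennreal_plus[OF st(1,2)] by (simp only: distrib_right)
        also have "\<dots> = ?R + ennreal (?\<epsilon> m)" using st by simp
        finally have "energy \<Omega> f (\<lambda>x. s * v x + t * w x) \<le> ?R + ennreal (?\<epsilon> m)" .
        then show "s *\<^sub>R v + t *\<^sub>R w \<in> ?C"
          unfolding eq using vw obstacle_class_convex_combination[OF \<open>open \<Omega>\<close> q st]
            sobolev_lincomb(1)[OF \<open>open \<Omega>\<close> p] by auto
      qed
      ultimately have "\<exists>v\<in>?C. sobolev_norm \<Omega> p (u - v) < ?\<epsilon> m"
        by (intro mazur_sobolev[OF \<open>open \<Omega>\<close> p Uu]) auto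
      then show ?thesis by blast
    qed
    then obtain v where v: "\<And>m. v m \<in> ?K \<inter> sobolev \<Omega> p" "\<And>m. energy \<Omega> f (v m) \<le> ?R + ennreal (?\<epsilon> m)"
      "\<And>m. sobolev_norm \<Omega> p (u - v m) < ?\<epsilon> m" by metis
    have "(\<lambda>m. sobolev_norm \<Omega> p (u - v m)) \<longlonglongrightarrow> 0"
    proof (rule tendsto_sandwich[OF _ _ tendsto_const LIMSEQ_inverse_real_of_nat])
      show "\<forall>\<^sub>F m in sequentially. 0 \<le> sobolev_norm \<Omega> p (u - v m)" by (simp add: sobolev_norm_def)
    qed (use v(3) in \<open>auto intro!: always_eventually less_imp_le\<close>)
    then have "weakly_converges \<Omega> p v u"
      using v(1) by (intro weakly_converges_if_sobolev_norm_tendsto_0[OF \<open>open \<Omega>\<close> p u]) auto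
    then have "v \<in> approximations \<Omega> p q u\<^sub>0 \<psi> u" using v(1) by (auto simp: approximations_def)
    moreover have "limsup (\<lambda>m. energy \<Omega> f (v m)) \<le> ?R"
    proof -
      have "(\<lambda>m. ?R + ennreal (?\<epsilon> m)) \<longlonglongrightarrow> ?R + ennreal 0"
        by (intro tendsto_add tendsto_const tendsto_ennrealI LIMSEQ_inverse_real_of_nat)
      then have "limsup (\<lambda>m. ?R + ennreal (?\<epsilon> m)) = ?R"
        by (simp add: lim_imp_Limsup)
      then show ?thesis using Limsup_mono[OF always_eventually, of "\<lambda>m. energy \<Omega> f (v m)"] v(2) by metis
    qed
    ultimately show ?thesis by blast
  qed
  then obtain U where U: "U \<in> approximations \<Omega> p q u\<^sub>0 \<psi> u" and "limsup (\<lambda>k. energy \<Omega> f (U k)) \<le> ?R" by blast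
  then have "(\<lambda>k. energy \<Omega> f (U k)) \<longlonglongrightarrow> ?R"
    using le_liminf[OF U] Liminf_le_Limsup[of sequentially "\<lambda>k. energy \<Omega> f (U k)"]
    by (intro Liminf_eq_Limsup) auto
  with U show "\<exists>U. (\<forall>k. U k \<in> ?K) \<and> weakly_converges \<Omega> p U u \<and> (\<lambda>k. energy \<Omega> f (U k)) \<longlonglongrightarrow> ?R"
    by (auto simp: approximations_def)
qed

end
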